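(* Let $\mathcal{P}$ be a unimodular probability measure on $\mathcal{G}_*$ and let $f$ be a vertex-shift. For $n\ge1$ let $\mathcal{P}_n=\mathcal{P}\circ\theta_f^{-n}$ be the push-forward of $\mathcal{P}$ under the $n$-th iterate of $\theta_f$. Let $\mathcal{Q}=\mathcal{P}\circ\Psi_f^{-1}$ and, for $n\ge1$, $\mathcal{Q}_n=\mathcal{Q}\circ\theta_F^{-n}$, where $F$ is the parent vertex-shift. Suppose there exist a (measurable) map $\Phi_f:\mathcal{T}_*\to\mathcal{G}_*$ and a probability measure $\mathcal{Q}_F$ on $\mathcal{T}_*$ such that 1. $\Phi_f\circ\Psi_f=\mathrm{Id}$, $\mathcal{P}$-almost surely; 2. $\mathcal{Q}_F$ is the $F$-probability of $\mathcal{Q}$, i.e. $\mathcal{Q}_n\to\mathcal{Q}_F$ weakly as $n\to\infty$; 3. $\Phi_f$ is continuous $\mathcal{Q}_F$-almost surely. Then $\mathcal{Q}_F\circ\Phi_f^{-1}$ is the $f$-probability of $\mathcal{P}$, i.e. $\mathcal{P}_n\to\mathcal{Q}_F\circ\Phi_f^{-1}$ weakly as $n\to\infty$.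
   Context: **Networks.** A network is a connected, locally finite graph $G$ whose vertices, and whose pairs (edge, endpoint), carry marks in $\mathbb{Z}$. $\mathcal{G}_*$ (resp. $\mathcal{G}_{**}$) is the Polish space of isomorphism classes of rooted (resp. doubly rooted) networks with the local topology (convergence means that balls of each radius around the root(s) are eventually isomorphic as marked rooted graphs). A probability measure $\mathcal{P}$ on $\mathcal{G}_*$ is unimodular if a random network $[\mathbf{G},\mathbf{o}]\sim\mathcal{P}$ satisfies $\mathbb{E}\big[\sum_{u\in V(\mathbf{G})}g([\mathbf{G},\mathbf{o},u])\big]=\mathbb{E}\big[\sum_{u\in V(\mathbf{G})}g([\mathbf{G},u,\mathbf{o}])\big]$ for all measurable $g:\mathcal{G}_{**}\to\mathbb{R}_{\ge0}$. **Family Trees.** A Family Tree is a locally finite directed tree in which each vertex has out-degree at most $1$. $\mathcal{T}_*$ is the Polish space of isomorphism classes of rooted Family Trees with the local topology. The parent vertex-shift $F$ maps each vertex of a Family Tree to its parent (endpoint of its outgoing edge) if it exists and to itself otherwise. **Vertex-shift.** A vertex-shift is a collection $f=(f_G)$ of maps $f_G:V(G)\to V(G)$ indexed by networks such that $f_H\circ\sigma=\sigma\circ f_G$ for each network isomorphism $\sigma:G\to H$, and $[G,u,v]\mapsto\mathbf{1}_{\{f_G(u)=v\}}$ is measurable on $\mathcal{G}_{**}$. It induces $\theta_f:\mathcal{G}_*\to\mathcal{G}_*$, $\theta_f([G,o])=[G,f_G(o)]$; likewise $\theta_F([T,o])=[T,F(o)]$ on $\mathcal{T}_*$. **Forward map.**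 The $f$-graph $G^f$ has vertex set $V(G)$ and directed edges $(u,f_G(u))$ for all $u$ with $f_G(u)\ne u$. $\Psi_f([G,o])=[G^f(o),o]\in\mathcal{T}_*$, where $G^f(o)$ is the connected component of $o$ in $G^f$. Standing convention: the components of the $f$-graphs considered (with self-loops discarded) are Family Trees, i.e. $f$ is such that $\Psi_f$ takes values in $\mathcal{T}_*$. *)

theory Defs
  imports "HOL-Probability.Probability"
begin

section \<open>Graphs, networks, isomorphisms\<close>

text \<open>
  Connected locally finite graphs are countable, so up to isomorphism all vertex sets are
  subsets of \<^typ>\<open>nat\<close>.  Fields are only meaningful on \<^term>\<open>verts\<close> (resp.\ \<^term>\<open>arcs\<close>); values
  elsewhere are ignored by isomorphisms.  For doubly rooted networks the ball of radius \<open>r\<close> is the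
  marked subgraph induced on the vertices within distance \<open>r\<close> of at least one root.

  In a network \<^term>\<open>arcs\<close> is the symmetric adjacency relation of a simple undirected graph, and
  \<open>emark (u, v)\<close> is the mark of the pair (edge \<open>{u, v}\<close>, endpoint \<open>u\<close>).  For a Family Tree,
  \<^term>\<open>arcs\<close> is the set of directed edges.
\<close>

record graph =
  verts :: "nat set"
  arcs :: "(nat \<times> nat) set"

record network = graph +
  vmark :: "nat \<Rightarrow> int"
  emark :: "nat \<times> nat \<Rightarrow> int"

definition wf_graph :: "'a graph_scheme \<Rightarrow> bool" where
  "wf_graph G \<longleftrightarrow> arcs G \<subseteq> verts G \<times> verts G \<and> irrefl (arcs G)"

definition adj :: "'a graph_scheme \<Rightarrow> (nat \<times> nat) set" where
  "adj G = arcs G \<union> (arcs G)\<inverse>"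

definition connected_graph :: "'a graph_scheme \<Rightarrow> bool" where
  "connected_graph G \<longleftrightarrow> verts G \<noteq> {} \<and> (\<forall>u\<in>verts G. \<forall>v\<in>verts G. (u, v) \<in> (adj G)\<^sup>*)"

definition locally_finite :: "'a graph_scheme \<Rightarrow> bool" where
  "locally_finite G \<longleftrightarrow> (\<forall>v\<in>verts G. finite (adj G `` {v}))"

definition is_network :: "network \<Rightarrow> bool" where
  "is_network G \<longleftrightarrow> wf_graph G \<and> sym (arcs G) \<and> connected_graph G \<and> locally_finite G"

text \<open>A cycle of the underlying undirected graph; together with antisymmetry of the directed edges
  (no 2-cycle in the underlying multigraph) its absence makes a connected directed graph a tree.\<close>

definition undirected_cycle :: "'a graph_scheme \<Rightarrow> nat list \<Rightarrow> bool" where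
  "undirected_cycle G vs \<longleftrightarrow> length vs \<ge> 3 \<and> distinct vs \<and> set vs \<subseteq> verts G \<and>
     successively (\<lambda>u v. (u, v) \<in> adj G) vs \<and> (last vs, hd vs) \<in> adj G"

definition directed_tree :: "graph \<Rightarrow> bool" where
  "directed_tree T \<longleftrightarrow> wf_graph T \<and> antisym (arcs T) \<and> connected_graph T \<and>
     (\<nexists>vs. undirected_cycle T vs)"

definition is_family_tree :: "graph \<Rightarrow> bool" where
  "is_family_tree T \<longleftrightarrow> directed_tree T \<and> locally_finite T \<and> single_valued (arcs T)"

definition graph_iso :: "(nat \<Rightarrow> nat) \<Rightarrow> 'a graph_scheme \<Rightarrow> 'b graph_scheme \<Rightarrow> bool" where
  "graph_iso \<sigma> G H \<longleftrightarrow> bij_betw \<sigma> (verts G) (verts H) \<and>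
     (\<forall>u\<in>verts G. \<forall>v\<in>verts G. (u, v) \<in> arcs G \<longleftrightarrow> (\<sigma> u, \<sigma> v) \<in> arcs H)"

definition network_iso :: "(nat \<Rightarrow> nat) \<Rightarrow> network \<Rightarrow> network \<Rightarrow> bool" where
  "network_iso \<sigma> G H \<longleftrightarrow> graph_iso \<sigma> G H \<and>
     (\<forall>v\<in>verts G. vmark H (\<sigma> v) = vmark G v) \<and>
     (\<forall>(u, v)\<in>arcs G. emark H (\<sigma> u, \<sigma> v) = emark G (u, v))"

definition induced :: "'a graph_scheme \<Rightarrow> nat set \<Rightarrow> 'a graph_scheme" where
  "induced G S = G\<lparr>verts := verts G \<inter> S, arcs := arcs G \<inter> S \<times> S\<rparr>"

definition ball_verts :: "nat \<Rightarrow> 'a graph_scheme \<Rightarrow> nat set \<Rightarrow> nat set" where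
  "ball_verts r G R = {v. \<exists>x\<in>R. \<exists>k\<le>r. (x, v) \<in> adj G ^^ k}"

text \<open>The ball of radius \<open>r\<close> around the set \<open>R\<close> of roots, with all directions and marks.\<close>

definition root_ball :: "nat \<Rightarrow> 'a graph_scheme \<Rightarrow> nat set \<Rightarrow> 'a graph_scheme" where
  "root_ball r G R = induced G (ball_verts r G R)"


subsection \<open>Basic properties of isomorphisms and balls\<close>

lemma wf_graph_adjD: "wf_graph G \<Longrightarrow> (u, v) \<in> adj G \<Longrightarrow> u \<in> verts G \<and> v \<in> verts G"
  by (auto simp: wf_graph_def adj_def)

lemma induced_simps [simp]:
  "verts (induced G S) = verts G \<inter> S"
  "arcs (induced G S) = arcs G \<inter> S \<times> S"
  "vmark (induced N S) = vmark N"
  "emark (induced N S) = emark N"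
  by (simp_all add: induced_def)

lemma adj_induced [simp]: "adj (induced G S) = adj G \<inter> S \<times> S"
  by (auto simp: adj_def)

lemma wf_graph_induced [intro]: "wf_graph G \<Longrightarrow> wf_graph (induced G S)"
  by (auto simp: wf_graph_def irrefl_def)

lemma wf_graph_root_ball [intro]: "wf_graph G \<Longrightarrow> wf_graph (root_ball r G R)"
  by (auto simp: root_ball_def)

lemma is_network_wf: "is_network G \<Longrightarrow> wf_graph G"
  by (simp add: is_network_def)

lemma is_family_tree_wf: "is_family_tree T \<Longrightarrow> wf_graph T"
  by (simp add: is_family_tree_def directed_tree_def)

lemma graph_iso_id: "graph_iso id G G"
  by (simp add: graph_iso_def)

lemma graph_iso_in: "graph_iso \<sigma> G H \<Longrightarrow> v \<in> verts G \<Longrightarrow> \<sigma> v \<in> verts H"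
  by (auto simp: graph_iso_def bij_betw_def)

lemma graph_iso_inv:
  assumes "graph_iso \<sigma> G H"
  shows "graph_iso (the_inv_into (verts G) \<sigma>) H G"
proof -
  have b: "bij_betw \<sigma> (verts G) (verts H)" using assms by (simp add: graph_iso_def)
  let ?\<tau> = "the_inv_into (verts G) \<sigma>"
  have b': "bij_betw ?\<tau> (verts H) (verts G)" using b by (rule bij_betw_the_inv_into)
  have inv: "\<sigma> (?\<tau> w) = w" "?\<tau> w \<in> verts G" if "w \<in> verts H" for w
    using that b f_the_inv_into_f_bij_betw[OF b] bij_betwE[OF b'] by auto
  show ?thesis
    using assms b' inv by (auto simp: graph_iso_def)
qed

lemma graph_iso_comp:
  assumes "graph_iso \<sigma> G H" "graph_iso \<tau> H K"
  shows "graph_iso (\<tau> \<circ> \<sigma>) G K"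
  using assms unfolding graph_iso_def by (auto intro: bij_betw_trans dest: bij_betwE)

lemma network_iso_id: "network_iso id G G"
  by (simp add: network_iso_def graph_iso_id split: prod.splits)

lemma network_iso_inv:
  assumes "network_iso \<sigma> G H" "wf_graph H"
  shows "network_iso (the_inv_into (verts G) \<sigma>) H G"
proof -
  let ?\<tau> = "the_inv_into (verts G) \<sigma>"
  have g: "graph_iso \<sigma> G H" using assms by (simp add: network_iso_def)
  have g': "graph_iso ?\<tau> H G" by (rule graph_iso_inv[OF g])
  have inv: "\<sigma> (?\<tau> w) = w" "?\<tau> w \<in> verts G" if "w \<in> verts H" for w
    using that g f_the_inv_into_f_bij_betw[of \<sigma>] graph_iso_in[OF g'] by (auto simp: graph_iso_def)
  have "emark G (?\<tau> u, ?\<tau> v) = emark H (u, v)" if uv: "(u, v) \<in> arcs H" for u v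
  proof -
    have V: "u \<in> verts H" "v \<in> verts H" using uv assms(2) by (auto simp: wf_graph_def)
    then have "(?\<tau> u, ?\<tau> v) \<in> arcs G" using g' uv by (simp add: graph_iso_def)
    then show ?thesis using assms(1) inv V by (fastforce simp: network_iso_def)
  qed
  moreover have "vmark G (?\<tau> v) = vmark H v" if "v \<in> verts H" for v
    using assms(1) inv[OF that] by (metis network_iso_def)
  ultimately show ?thesis using g' by (auto simp: network_iso_def)
qed

lemma network_iso_comp:
  assumes "network_iso \<sigma> G H" "network_iso \<tau> H K" "wf_graph G"
  shows "network_iso (\<tau> \<circ> \<sigma>) G K"
proof -
  have g: "graph_iso \<sigma> G H" "graph_iso \<tau> H K" using assms by (simp_all add: network_iso_def)
  have "(\<sigma> u, \<sigma> v) \<in> arcs H" if "(u, v) \<in> arcs G" for u v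
    using that g(1) assms(3) by (auto simp: graph_iso_def wf_graph_def)
  then show ?thesis
    using assms graph_iso_comp[OF g] graph_iso_in[OF g(1)] by (fastforce simp: network_iso_def)
qed

lemma graph_iso_adj_iff:
  "graph_iso \<sigma> G H \<Longrightarrow> u \<in> verts G \<Longrightarrow> v \<in> verts G \<Longrightarrow> (\<sigma> u, \<sigma> v) \<in> adj H \<longleftrightarrow> (u, v) \<in> adj G"
  by (auto simp: graph_iso_def adj_def)

lemma graph_iso_relpow:
  assumes "graph_iso \<sigma> G H" "wf_graph G" "(u, v) \<in> adj G ^^ k" "u \<in> verts G"
  shows "(\<sigma> u, \<sigma> v) \<in> adj H ^^ k \<and> v \<in> verts G"
  using assms(3)
proof (induction k arbitrary: v)
  case 0
  then show ?case using assms(4) by simp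
next
  case (Suc k)
  then obtain w where w: "(u, w) \<in> adj G ^^ k" "(w, v) \<in> adj G" by auto
  have "w \<in> verts G" "v \<in> verts G" using wf_graph_adjD[OF assms(2) w(2)] by auto
  then show ?case
    using Suc.IH[OF w(1)] w(2) graph_iso_adj_iff[OF assms(1)] by (auto intro: relcompI)
qed

lemma ball_verts_subset: "wf_graph G \<Longrightarrow> R \<subseteq> verts G \<Longrightarrow> ball_verts r G R \<subseteq> verts G"
  using graph_iso_relpow[OF graph_iso_id] by (fastforce simp: ball_verts_def)

lemma roots_subset_ball: "R \<subseteq> ball_verts r G R"
  by (auto simp: ball_verts_def intro!: exI[of _ 0] bexI)

lemma ball_verts_mono: "r \<le> s \<Longrightarrow> ball_verts r G R \<subseteq> ball_verts s G R"
  unfolding ball_verts_def by (blast intro: order_trans)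

lemma graph_iso_ball_verts:
  assumes "graph_iso \<sigma> G H" "wf_graph G" "wf_graph H" "R \<subseteq> verts G"
  shows "ball_verts r H (\<sigma> ` R) = \<sigma> ` ball_verts r G R"
proof
  show "\<sigma> ` ball_verts r G R \<subseteq> ball_verts r H (\<sigma> ` R)"
    using graph_iso_relpow[OF assms(1,2)] assms(4) by (fastforce simp: ball_verts_def)
next
  let ?\<tau> = "the_inv_into (verts G) \<sigma>"
  have b: "bij_betw \<sigma> (verts G) (verts H)" using assms(1) by (simp add: graph_iso_def)
  show "ball_verts r H (\<sigma> ` R) \<subseteq> \<sigma> ` ball_verts r G R"
  proof
    fix w assume "w \<in> ball_verts r H (\<sigma> ` R)"
    then obtain x k where x: "x \<in> R" "k \<le> r" "(\<sigma> x, w) \<in> adj H ^^ k"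
      by (auto simp: ball_verts_def)
    have xV: "x \<in> verts G" using x assms(4) by auto
    have "(?\<tau> (\<sigma> x), ?\<tau> w) \<in> adj G ^^ k \<and> w \<in> verts H"
      using graph_iso_relpow[OF graph_iso_inv[OF assms(1)] assms(3) x(3)] graph_iso_in[OF assms(1) xV]
      by simp
    moreover have "?\<tau> (\<sigma> x) = x" using xV b by (simp add: the_inv_into_f_f bij_betw_def)
    moreover have "\<sigma> (?\<tau> w) = w" if "w \<in> verts H" using f_the_inv_into_f_bij_betw[OF b] that by simp
    ultimately show "w \<in> \<sigma> ` ball_verts r G R"
      using x by (force simp: ball_verts_def)
  qed
qed

lemma graph_iso_induced:
  assumes "graph_iso \<sigma> G H" "S \<subseteq> verts G"
  shows "graph_iso \<sigma> (induced G S) (induced H (\<sigma> ` S))"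
proof -
  have b: "bij_betw \<sigma> (verts G) (verts H)" using assms(1) by (simp add: graph_iso_def)
  have "bij_betw \<sigma> S (\<sigma> ` S)" using b assms(2) by (meson bij_betw_subset)
  moreover have "\<sigma> ` S \<subseteq> verts H" using b assms(2) by (auto simp: bij_betw_def)
  ultimately show ?thesis
    using assms by (auto simp: graph_iso_def Int_absorb1 subset_iff)
qed

lemma graph_iso_root_ball:
  assumes "graph_iso \<sigma> G H" "wf_graph G" "wf_graph H" "R \<subseteq> verts G"
  shows "graph_iso \<sigma> (root_ball r G R) (root_ball r H (\<sigma> ` R))"
  unfolding root_ball_def graph_iso_ball_verts[OF assms]
  using assms ball_verts_subset[OF assms(2,4)] by (auto intro: graph_iso_induced)

lemma network_iso_root_ball:
  assumes "network_iso \<sigma> G H" "wf_graph G" "wf_graph H" "R \<subseteq> verts G"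
  shows "network_iso \<sigma> (root_ball r G R) (root_ball r H (\<sigma> ` R))"
proof -
  have "graph_iso \<sigma> (root_ball r G R) (root_ball r H (\<sigma> ` R))"
    using assms by (intro graph_iso_root_ball) (auto simp: network_iso_def)
  then show ?thesis
    using assms(1) by (fastforce simp: network_iso_def root_ball_def)
qed

lemma relpow_ball_induced:
  assumes "(x, v) \<in> adj G ^^ k" "x \<in> R" "k \<le> s"
  shows "(x, v) \<in> adj (induced G (ball_verts s G R)) ^^ k"
  using assms(1,3)
proof (induction k arbitrary: v)
  case (Suc k)
  then obtain w where w: "(x, w) \<in> adj G ^^ k" "(w, v) \<in> adj G" by auto
  have "w \<in> ball_verts s G R"
    using w(1) Suc.prems assms(2) unfolding ball_verts_def
    by (auto intro!: bexI[of _ x] exI[of _ k])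
  moreover have "v \<in> ball_verts s G R"
    using Suc.prems assms(2) unfolding ball_verts_def
    by (intro CollectI bexI[of _ x] exI[of _ "Suc k"]) auto
  ultimately show ?case
    using Suc.IH[OF w(1)] Suc.prems w(2) by (auto intro!: relcompI[of _ w])
qed auto

lemma root_ball_root_ball:
  assumes "r \<le> s"
  shows "root_ball r (root_ball s G R) R = root_ball r G R"
proof -
  have mono: "(x, v) \<in> adj G ^^ k" if "(x, v) \<in> adj (induced G S) ^^ k" for x v k and S :: "nat set"
    using that by (induction k arbitrary: v) auto
  have "ball_verts r (root_ball s G R) R = ball_verts r G R"
  proof
    show "ball_verts r (root_ball s G R) R \<subseteq> ball_verts r G R"
      using mono unfolding ball_verts_def root_ball_def by blast
    show "ball_verts r G R \<subseteq> ball_verts r (root_ball s G R) R"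
    proof
      fix v assume "v \<in> ball_verts r G R"
      then obtain x k where "x \<in> R" "k \<le> r" "(x, v) \<in> adj G ^^ k" by (auto simp: ball_verts_def)
      then show "v \<in> ball_verts r (root_ball s G R) R"
        using relpow_ball_induced[of x v k G R s] assms
        unfolding ball_verts_def root_ball_def by auto
    qed
  qed
  then show ?thesis
    using ball_verts_mono[OF assms, of G R] by (auto simp: root_ball_def induced_def Int_assoc
        intro!: arg_cong2[where f = "\<lambda>A B. G\<lparr>verts := A, arcs := B\<rparr>"])
qed


section \<open>The spaces of rooted networks, doubly rooted networks and rooted Family Trees\<close>

subsection \<open>Isomorphism of structures with a list of roots\<close>

definition rnet_rel :: "network \<times> nat list \<Rightarrow> network \<times> nat list \<Rightarrow> bool" where
  "rnet_rel = (\<lambda>(G, os) (H, ps). is_network G \<and> is_network H \<and> set os \<subseteq> verts G \<and>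
     (\<exists>\<sigma>. network_iso \<sigma> G H \<and> map \<sigma> os = ps))"

definition rtree_rel :: "graph \<times> nat list \<Rightarrow> graph \<times> nat list \<Rightarrow> bool" where
  "rtree_rel = (\<lambda>(S, os) (T, ps). is_family_tree S \<and> is_family_tree T \<and> set os \<subseteq> verts S \<and>
     (\<exists>\<sigma>. graph_iso \<sigma> S T \<and> map \<sigma> os = ps))"

definition net_balls_iso :: "nat \<Rightarrow> network \<times> nat list \<Rightarrow> network \<times> nat list \<Rightarrow> bool" where
  "net_balls_iso r = (\<lambda>(G, os) (H, ps).
     \<exists>\<sigma>. network_iso \<sigma> (root_ball r G (set os)) (root_ball r H (set ps)) \<and> map \<sigma> os = ps)"

definition tree_balls_iso :: "nat \<Rightarrow> graph \<times> nat list \<Rightarrow> graph \<times> nat list \<Rightarrow> bool" where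
  "tree_balls_iso r = (\<lambda>(S, os) (T, ps).
     \<exists>\<sigma>. graph_iso \<sigma> (root_ball r S (set os)) (root_ball r T (set ps)) \<and> map \<sigma> os = ps)"


lemma rnet_rel_sym: "rnet_rel p q \<Longrightarrow> rnet_rel q p"
proof -
  assume a: "rnet_rel p q"
  obtain G xs H ys where pq: "p = (G, xs)" "q = (H, ys)" by (metis surj_pair)
  obtain \<sigma> where s: "is_network G" "is_network H" "set xs \<subseteq> verts G" "network_iso \<sigma> G H" "map \<sigma> xs = ys"
    using a by (auto simp: rnet_rel_def pq)
  have g: "graph_iso \<sigma> G H" "inj_on \<sigma> (verts G)" using s by (auto simp: network_iso_def graph_iso_def bij_betw_def)
  let ?\<tau> = "the_inv_into (verts G) \<sigma>"
  have "map ?\<tau> ys = xs"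
    using s(3,5) g(2) by (auto simp: the_inv_into_f_f subset_iff intro!: map_idI)
  moreover have "set ys \<subseteq> verts H" unfolding s(5)[symmetric] using s(3) graph_iso_in[OF g(1)] by auto
  ultimately show ?thesis
    using s network_iso_inv[OF s(4) is_network_wf[OF s(2)]] by (auto simp: rnet_rel_def pq)
qed

lemma rnet_rel_trans:
  assumes "rnet_rel p q" "rnet_rel q s"
  shows "rnet_rel p s"
proof -
  obtain G xs H ys K zs where pq: "p = (G, xs)" "q = (H, ys)" "s = (K, zs)" by (metis surj_pair)
  obtain \<sigma> \<tau> where n: "is_network G" "is_network K" "set xs \<subseteq> verts G"
    and s: "network_iso \<sigma> G H" "map \<sigma> xs = ys" and t: "network_iso \<tau> H K" "map \<tau> ys = zs"
    using assms unfolding rnet_rel_def pq by blast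
  have "map (\<tau> \<circ> \<sigma>) xs = zs" using s(2) t(2) by auto
  then show ?thesis
    unfolding rnet_rel_def pq using n network_iso_comp[OF s(1) t(1) is_network_wf[OF n(1)]] by blast
qed

lemma rtree_rel_sym: "rtree_rel p q \<Longrightarrow> rtree_rel q p"
proof -
  assume a: "rtree_rel p q"
  obtain G xs H ys where pq: "p = (G, xs)" "q = (H, ys)" by (metis surj_pair)
  obtain \<sigma> where s: "is_family_tree G" "is_family_tree H" "set xs \<subseteq> verts G" "graph_iso \<sigma> G H" "map \<sigma> xs = ys"
    using a by (auto simp: rtree_rel_def pq)
  have g: "inj_on \<sigma> (verts G)" using s by (auto simp: graph_iso_def bij_betw_def)
  let ?\<tau> = "the_inv_into (verts G) \<sigma>"
  have "map ?\<tau> ys = xs"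
    using s(3,5) g by (auto simp: the_inv_into_f_f subset_iff intro!: map_idI)
  moreover have "set ys \<subseteq> verts H" unfolding s(5)[symmetric] using s(3) graph_iso_in[OF s(4)] by auto
  ultimately show ?thesis
    using s graph_iso_inv[OF s(4)] by (auto simp: rtree_rel_def pq)
qed

lemma rtree_rel_trans:
  assumes "rtree_rel p q" "rtree_rel q s"
  shows "rtree_rel p s"
proof -
  obtain G xs H ys K zs where pq: "p = (G, xs)" "q = (H, ys)" "s = (K, zs)" by (metis surj_pair)
  obtain \<sigma> \<tau> where n: "is_family_tree G" "is_family_tree K" "set xs \<subseteq> verts G"
    and s: "graph_iso \<sigma> G H" "map \<sigma> xs = ys" and t: "graph_iso \<tau> H K" "map \<tau> ys = zs"
    using assms unfolding rtree_rel_def pq by blast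
  have "map (\<tau> \<circ> \<sigma>) xs = zs" using s(2) t(2) by auto
  then show ?thesis
    unfolding rtree_rel_def pq using n graph_iso_comp[OF s(1) t(1)] by blast
qed

lemma net_balls_iso_refl: "net_balls_iso r p p"
  by (auto simp: net_balls_iso_def intro!: exI[of _ id] network_iso_id split: prod.splits)

lemma tree_balls_iso_refl: "tree_balls_iso r p p"
  by (auto simp: tree_balls_iso_def intro!: exI[of _ id] graph_iso_id split: prod.splits)

lemma net_balls_iso_trans:
  assumes "wf_graph (fst p)" "net_balls_iso r p q" "net_balls_iso r q s"
  shows "net_balls_iso r p s"
proof -
  obtain G xs H ys K zs where pq: "p = (G, xs)" "q = (H, ys)" "s = (K, zs)" by (metis surj_pair)
  let ?b = "root_ball r"
  obtain \<sigma> \<tau> where s: "network_iso \<sigma> (?b G (set xs)) (?b H (set ys))" "map \<sigma> xs = ys"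
    and t: "network_iso \<tau> (?b H (set ys)) (?b K (set zs))" "map \<tau> ys = zs"
    using assms(2,3) unfolding net_balls_iso_def pq by blast
  have "network_iso (\<tau> \<circ> \<sigma>) (?b G (set xs)) (?b K (set zs))"
    using network_iso_comp[OF s(1) t(1)] assms(1) pq by auto
  moreover have "map (\<tau> \<circ> \<sigma>) xs = zs" using s(2) t(2) by auto
  ultimately show ?thesis unfolding net_balls_iso_def pq by blast
qed

lemma tree_balls_iso_trans:
  assumes "tree_balls_iso r p q" "tree_balls_iso r q s"
  shows "tree_balls_iso r p s"
proof -
  obtain G xs H ys K zs where pq: "p = (G, xs)" "q = (H, ys)" "s = (K, zs)" by (metis surj_pair)
  let ?b = "root_ball r"
  obtain \<sigma> \<tau> where s: "graph_iso \<sigma> (?b G (set xs)) (?b H (set ys))" "map \<sigma> xs = ys"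
    and t: "graph_iso \<tau> (?b H (set ys)) (?b K (set zs))" "map \<tau> ys = zs"
    using assms unfolding tree_balls_iso_def pq by blast
  have "map (\<tau> \<circ> \<sigma>) xs = zs" using s(2) t(2) by auto
  then show ?thesis unfolding tree_balls_iso_def pq using graph_iso_comp[OF s(1) t(1)] by blast
qed

lemma rnet_rel_imp_balls_iso:
  assumes "rnet_rel p q"
  shows "net_balls_iso r p q"
proof -
  obtain G xs H ys where pq: "p = (G, xs)" "q = (H, ys)" by (metis surj_pair)
  obtain \<sigma> where s: "is_network G" "is_network H" "set xs \<subseteq> verts G" "network_iso \<sigma> G H" "map \<sigma> xs = ys"
    using assms unfolding rnet_rel_def pq by blast
  have "\<sigma> ` set xs = set ys" using s(5) by auto
  then have "network_iso \<sigma> (root_ball r G (set xs)) (root_ball r H (set ys))"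
    using network_iso_root_ball[OF s(4) is_network_wf[OF s(1)] is_network_wf[OF s(2)] s(3), of r] by simp
  then show ?thesis unfolding net_balls_iso_def pq using s(5) by blast
qed

lemma rtree_rel_imp_balls_iso:
  assumes "rtree_rel p q"
  shows "tree_balls_iso r p q"
proof -
  obtain G xs H ys where pq: "p = (G, xs)" "q = (H, ys)" by (metis surj_pair)
  obtain \<sigma> where s: "is_family_tree G" "is_family_tree H" "set xs \<subseteq> verts G" "graph_iso \<sigma> G H" "map \<sigma> xs = ys"
    using assms unfolding rtree_rel_def pq by blast
  have "\<sigma> ` set xs = set ys" using s(5) by auto
  then have "graph_iso \<sigma> (root_ball r G (set xs)) (root_ball r H (set ys))"
    using graph_iso_root_ball[OF s(4) is_family_tree_wf[OF s(1)] is_family_tree_wf[OF s(2)] s(3), of r] by simp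
  then show ?thesis unfolding tree_balls_iso_def pq using s(5) by blast
qed

lemma net_balls_iso_cong:
  assumes "rnet_rel p p'" "rnet_rel q q'"
  shows "net_balls_iso r p q \<longleftrightarrow> net_balls_iso r p' q'"
proof -
  have "wf_graph (fst p)" "wf_graph (fst p')" "wf_graph (fst q)" "wf_graph (fst q')"
    using assms by (auto simp: rnet_rel_def intro: is_network_wf)
  then show ?thesis
    using assms[THEN rnet_rel_imp_balls_iso[of _ _ r]]
      assms[THEN rnet_rel_sym, THEN rnet_rel_imp_balls_iso[of _ _ r]]
    by (metis net_balls_iso_trans)
qed

lemma tree_balls_iso_cong:
  assumes "rtree_rel p p'" "rtree_rel q q'"
  shows "tree_balls_iso r p q \<longleftrightarrow> tree_balls_iso r p' q'"
  using assms[THEN rtree_rel_imp_balls_iso[of _ _ r]]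
    assms[THEN rtree_rel_sym, THEN rtree_rel_imp_balls_iso[of _ _ r]]
  by (metis tree_balls_iso_trans)

lemma net_balls_iso_mono:
  assumes "net_balls_iso s (G, xs) (H, ys)" "r \<le> s" "wf_graph G" "wf_graph H" "set xs \<subseteq> verts G"
  shows "net_balls_iso r (G, xs) (H, ys)"
proof -
  obtain \<sigma> where s: "network_iso \<sigma> (root_ball s G (set xs)) (root_ball s H (set ys))" "map \<sigma> xs = ys"
    using assms(1) by (auto simp: net_balls_iso_def)
  have "network_iso \<sigma> (root_ball r (root_ball s G (set xs)) (set xs))
      (root_ball r (root_ball s H (set ys)) (\<sigma> ` set xs))"
    using assms roots_subset_ball[of "set xs" s G]
    by (intro network_iso_root_ball s(1)) (auto simp: root_ball_def dest: subsetD)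
  moreover have "\<sigma> ` set xs = set ys" using s(2) by auto
  ultimately show ?thesis
    using s(2) assms(2) by (auto simp: net_balls_iso_def root_ball_root_ball)
qed

lemma tree_balls_iso_mono:
  assumes "tree_balls_iso s (G, xs) (H, ys)" "r \<le> s" "wf_graph G" "wf_graph H" "set xs \<subseteq> verts G"
  shows "tree_balls_iso r (G, xs) (H, ys)"
proof -
  obtain \<sigma> where s: "graph_iso \<sigma> (root_ball s G (set xs)) (root_ball s H (set ys))" "map \<sigma> xs = ys"
    using assms(1) by (auto simp: tree_balls_iso_def)
  have "graph_iso \<sigma> (root_ball r (root_ball s G (set xs)) (set xs))
      (root_ball r (root_ball s H (set ys)) (\<sigma> ` set xs))"
    using assms roots_subset_ball[of "set xs" s G]
    by (intro graph_iso_root_ball s(1)) (auto simp: root_ball_def dest: subsetD)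
  moreover have "\<sigma> ` set xs = set ys" using s(2) by auto
  ultimately show ?thesis
    using s(2) assms(2) by (auto simp: tree_balls_iso_def root_ball_root_ball)
qed

definition single_network :: network where
  "single_network = \<lparr>verts = {0}, arcs = {}, vmark = (\<lambda>_. 0), emark = (\<lambda>_. 0)\<rparr>"

definition single_tree :: graph where
  "single_tree = \<lparr>verts = {0}, arcs = {}\<rparr>"

lemma is_network_single: "is_network single_network"
  by (auto simp: is_network_def single_network_def wf_graph_def irrefl_def sym_def
      connected_graph_def locally_finite_def adj_def)

lemma is_family_tree_single: "is_family_tree single_tree"
proof -
  have "\<not> undirected_cycle single_tree vs" for vs
    by (auto simp: undirected_cycle_def single_tree_def adj_def)
  then show ?thesis
    by (auto simp: is_family_tree_def directed_tree_def single_tree_def wf_graph_def irrefl_def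
        antisym_def connected_graph_def locally_finite_def adj_def)
qed


subsection \<open>Isomorphism classes\<close>

definition net1_rel :: "network \<times> nat \<Rightarrow> network \<times> nat \<Rightarrow> bool" where
  "net1_rel = (\<lambda>(G, x) (H, y). rnet_rel (G, [x]) (H, [y]))"

definition net2_rel :: "network \<times> nat \<times> nat \<Rightarrow> network \<times> nat \<times> nat \<Rightarrow> bool" where
  "net2_rel = (\<lambda>(G, x, u) (H, y, v). rnet_rel (G, [x, u]) (H, [y, v]))"

definition tree1_rel :: "graph \<times> nat \<Rightarrow> graph \<times> nat \<Rightarrow> bool" where
  "tree1_rel = (\<lambda>(S, x) (T, y). rtree_rel (S, [x]) (T, [y]))"

lemma net1_rel_iff: "net1_rel (G, x) (H, y) \<longleftrightarrow>
    is_network G \<and> is_network H \<and> x \<in> verts G \<and> (\<exists>\<sigma>. network_iso \<sigma> G H \<and> \<sigma> x = y)"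
  by (simp add: net1_rel_def rnet_rel_def)

lemma net2_rel_iff: "net2_rel (G, x, u) (H, y, v) \<longleftrightarrow>
    is_network G \<and> is_network H \<and> x \<in> verts G \<and> u \<in> verts G \<and>
    (\<exists>\<sigma>. network_iso \<sigma> G H \<and> \<sigma> x = y \<and> \<sigma> u = v)"
  by (auto simp: net2_rel_def rnet_rel_def)

lemma tree1_rel_iff: "tree1_rel (S, x) (T, y) \<longleftrightarrow>
    is_family_tree S \<and> is_family_tree T \<and> x \<in> verts S \<and> (\<exists>\<sigma>. graph_iso \<sigma> S T \<and> \<sigma> x = y)"
  by (simp add: tree1_rel_def rtree_rel_def)

lemma part_equivp_net1_rel: "part_equivp net1_rel"
proof (rule part_equivpI)
  show "\<exists>p. net1_rel p p"
    using is_network_single network_iso_id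
    by (intro exI[of _ "(single_network, 0)"]) (auto simp: net1_rel_iff single_network_def intro!: exI[of _ id])
  show "symp net1_rel" by (auto simp: symp_def net1_rel_def intro: rnet_rel_sym)
  show "transp net1_rel" by (auto simp: transp_def net1_rel_def intro: rnet_rel_trans)
qed

lemma part_equivp_net2_rel: "part_equivp net2_rel"
proof (rule part_equivpI)
  show "\<exists>p. net2_rel p p"
    using is_network_single network_iso_id
    by (intro exI[of _ "(single_network, 0, 0)"]) (auto simp: net2_rel_iff single_network_def intro!: exI[of _ id])
  show "symp net2_rel" by (auto simp: symp_def net2_rel_def intro: rnet_rel_sym)
  show "transp net2_rel" by (auto simp: transp_def net2_rel_def intro: rnet_rel_trans)
qed

lemma part_equivp_tree1_rel: "part_equivp tree1_rel"
proof (rule part_equivpI)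
  show "\<exists>p. tree1_rel p p"
    using is_family_tree_single graph_iso_id
    by (intro exI[of _ "(single_tree, 0)"]) (auto simp: tree1_rel_iff single_tree_def intro!: exI[of _ id])
  show "symp tree1_rel" by (auto simp: symp_def tree1_rel_def intro: rtree_rel_sym)
  show "transp tree1_rel" by (auto simp: transp_def tree1_rel_def intro: rtree_rel_trans)
qed

quotient_type rooted_network = "network \<times> nat" / partial: net1_rel
  by (rule part_equivp_net1_rel)

quotient_type doubly_rooted_network = "network \<times> nat \<times> nat" / partial: net2_rel
  by (rule part_equivp_net2_rel)

quotient_type rooted_tree = "graph \<times> nat" / partial: tree1_rel
  by (rule part_equivp_tree1_rel)

text \<open>The classes \<open>[G, x]\<close>, \<open>[G, x, u]\<close> and \<open>[T, x]\<close>.\<close>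

definition net1 :: "network \<Rightarrow> nat \<Rightarrow> rooted_network" where
  "net1 G x = abs_rooted_network (G, x)"

definition net2 :: "network \<Rightarrow> nat \<Rightarrow> nat \<Rightarrow> doubly_rooted_network" where
  "net2 G x u = abs_doubly_rooted_network (G, x, u)"

definition tree1 :: "graph \<Rightarrow> nat \<Rightarrow> rooted_tree" where
  "tree1 T x = abs_rooted_tree (T, x)"

lemma net1_rel_refl: "is_network G \<Longrightarrow> x \<in> verts G \<Longrightarrow> net1_rel (G, x) (G, x)"
  by (auto simp: net1_rel_iff intro!: exI[of _ id] network_iso_id)

lemma net1_eq_iff:
  assumes "is_network G" "x \<in> verts G" "is_network H" "y \<in> verts H"
  shows "net1 G x = net1 H y \<longleftrightarrow> net1_rel (G, x) (H, y)"
  using assms Quotient3_rel[OF Quotient3_rooted_network, of "(G, x)" "(H, y)"]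
  by (auto simp: net1_def net1_rel_refl)

lemma net2_eqI: "net2_rel (G, x, u) (H, y, v) \<Longrightarrow> net2 G x u = net2 H y v"
  using Quotient3_rel[OF Quotient3_doubly_rooted_network, of "(G, x, u)" "(H, y, v)"]
  by (auto simp: net2_def)

lemma tree1_eqI: "tree1_rel (S, x) (T, y) \<Longrightarrow> tree1 S x = tree1 T y"
  using Quotient3_rel[OF Quotient3_rooted_tree, of "(S, x)" "(T, y)"]
  by (auto simp: tree1_def)

lemma rep_net1:
  assumes "is_network G" "x \<in> verts G"
  shows "net1_rel (rep_rooted_network (net1 G x)) (G, x)"
  unfolding net1_def using rep_abs_rsp_left[OF Quotient3_rooted_network net1_rel_refl[OF assms]] by simp


subsection \<open>Local topology\<close>

lift_definition net1_balls_iso :: "nat \<Rightarrow> rooted_network \<Rightarrow> rooted_network \<Rightarrow> bool" is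
  "\<lambda>r (G, x) (H, y). net_balls_iso r (G, [x]) (H, [y])"
  by (auto simp: net1_rel_def dest: net_balls_iso_cong)

lift_definition net2_balls_iso :: "nat \<Rightarrow> doubly_rooted_network \<Rightarrow> doubly_rooted_network \<Rightarrow> bool" is
  "\<lambda>r (G, x, u) (H, y, v). net_balls_iso r (G, [x, u]) (H, [y, v])"
  by (auto simp: net2_rel_def dest: net_balls_iso_cong)

lift_definition tree1_balls_iso :: "nat \<Rightarrow> rooted_tree \<Rightarrow> rooted_tree \<Rightarrow> bool" is
  "\<lambda>r (S, x) (T, y). tree_balls_iso r (S, [x]) (T, [y])"
  by (auto simp: tree1_rel_def dest: tree_balls_iso_cong)

lemma net1_balls_iso_refl: "net1_balls_iso r p p"
  by transfer (auto intro: net_balls_iso_refl)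

lemma net2_balls_iso_refl: "net2_balls_iso r p p"
  by transfer (auto intro: net_balls_iso_refl)

lemma tree1_balls_iso_refl: "tree1_balls_iso r p p"
  by transfer (auto intro: tree_balls_iso_refl)

lemma net1_balls_iso_trans: "net1_balls_iso r p q \<Longrightarrow> net1_balls_iso r q s \<Longrightarrow> net1_balls_iso r p s"
  by transfer (clarsimp simp: net1_rel_iff, erule (1) net_balls_iso_trans[rotated], simp add: is_network_wf)

lemma net2_balls_iso_trans: "net2_balls_iso r p q \<Longrightarrow> net2_balls_iso r q s \<Longrightarrow> net2_balls_iso r p s"
  by transfer (clarsimp simp: net2_rel_iff, erule (1) net_balls_iso_trans[rotated], simp add: is_network_wf)

lemma tree1_balls_iso_trans: "tree1_balls_iso r p q \<Longrightarrow> tree1_balls_iso r q s \<Longrightarrow> tree1_balls_iso r p s"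
  by transfer (auto intro: tree_balls_iso_trans)

lemma net1_balls_iso_mono: "net1_balls_iso s p q \<Longrightarrow> r \<le> s \<Longrightarrow> net1_balls_iso r p q"
  by transfer (clarsimp simp: net1_rel_iff, erule net_balls_iso_mono, simp_all add: is_network_wf)

lemma net2_balls_iso_mono: "net2_balls_iso s p q \<Longrightarrow> r \<le> s \<Longrightarrow> net2_balls_iso r p q"
  by transfer (clarsimp simp: net2_rel_iff, erule net_balls_iso_mono, simp_all add: is_network_wf)

lemma tree1_balls_iso_mono: "tree1_balls_iso s p q \<Longrightarrow> r \<le> s \<Longrightarrow> tree1_balls_iso r p q"
  by transfer (clarsimp simp: tree1_rel_iff, erule tree_balls_iso_mono, simp_all add: is_family_tree_wf)

lemma local_topologyI:
  assumes "\<And>r s x y. R s x y \<Longrightarrow> r \<le> s \<Longrightarrow> R r x y"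
  shows "class.topological_space (\<lambda>U. \<forall>x\<in>U. \<exists>r::nat. \<forall>y. R r x y \<longrightarrow> y \<in> U)"
proof
  fix S T :: "'a set"
  assume "\<forall>x\<in>S. \<exists>r. \<forall>y. R r x y \<longrightarrow> y \<in> S" "\<forall>x\<in>T. \<exists>r. \<forall>y. R r x y \<longrightarrow> y \<in> T"
  then show "\<forall>x\<in>S \<inter> T. \<exists>r. \<forall>y. R r x y \<longrightarrow> y \<in> S \<inter> T"
    by (metis IntE IntI assms max.cobounded1 max.cobounded2)
qed (simp, meson Union_iff)

instantiation rooted_network :: topological_space
begin
definition open_rooted_network :: "rooted_network set \<Rightarrow> bool" where
  "open_rooted_network U \<longleftrightarrow> (\<forall>p\<in>U. \<exists>r. \<forall>q. net1_balls_iso r p q \<longrightarrow> q \<in> U)"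
instance
  by (rule topological_space.intro_of_class,
      unfold open_rooted_network_def[abs_def], rule local_topologyI, rule net1_balls_iso_mono)
end

instantiation doubly_rooted_network :: topological_space
begin
definition open_doubly_rooted_network :: "doubly_rooted_network set \<Rightarrow> bool" where
  "open_doubly_rooted_network U \<longleftrightarrow> (\<forall>p\<in>U. \<exists>r. \<forall>q. net2_balls_iso r p q \<longrightarrow> q \<in> U)"
instance
  by (rule topological_space.intro_of_class,
      unfold open_doubly_rooted_network_def[abs_def], rule local_topologyI, rule net2_balls_iso_mono)
end

instantiation rooted_tree :: topological_space
begin
definition open_rooted_tree :: "rooted_tree set \<Rightarrow> bool" where
  "open_rooted_tree U \<longleftrightarrow> (\<forall>p\<in>U. \<exists>r. \<forall>q. tree1_balls_iso r p q \<longrightarrow> q \<in> U)"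
instance
  by (rule topological_space.intro_of_class,
      unfold open_rooted_tree_def[abs_def], rule local_topologyI, rule tree1_balls_iso_mono)
end

lemma local_topology_tendsto_iff:
  fixes X :: "'b \<Rightarrow> 'a :: topological_space"
  assumes op: "\<And>U :: 'a set. open U \<longleftrightarrow> (\<forall>x\<in>U. \<exists>r::nat. \<forall>y. R r x y \<longrightarrow> y \<in> U)"
    and refl: "\<And>r x. R r x x" and trans: "\<And>r x y z. R r x y \<Longrightarrow> R r y z \<Longrightarrow> R r x z"
  shows "(X \<longlongrightarrow> x) F \<longleftrightarrow> (\<forall>r. \<forall>\<^sub>F n in F. R r x (X n))"
proof
  assume lim: "(X \<longlongrightarrow> x) F"
  show "\<forall>r. \<forall>\<^sub>F n in F. R r x (X n)"
  proof
    fix r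
    have "open {y. R r x y}" unfolding op using trans by blast
    then show "\<forall>\<^sub>F n in F. R r x (X n)" using topological_tendstoD[OF lim, of "{y. R r x y}"] refl by simp
  qed
next
  assume ev: "\<forall>r. \<forall>\<^sub>F n in F. R r x (X n)"
  show "(X \<longlongrightarrow> x) F"
  proof (rule topological_tendstoI)
    fix S assume "open S" "x \<in> S"
    then obtain r where "\<forall>y. R r x y \<longrightarrow> y \<in> S" by (auto simp: op)
    then show "\<forall>\<^sub>F n in F. X n \<in> S" using ev[rule_format, of r] by (simp add: eventually_mono)
  qed
qed

text \<open>The topologies induce the intended convergence.\<close>

lemma rooted_network_tendsto_iff:
  "(X \<longlongrightarrow> p) F \<longleftrightarrow> (\<forall>r. \<forall>\<^sub>F n in F. net1_balls_iso r p (X n))"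
  by (rule local_topology_tendsto_iff)
    (auto simp: open_rooted_network_def intro: net1_balls_iso_refl net1_balls_iso_trans)

lemma doubly_rooted_network_tendsto_iff:
  "(X \<longlongrightarrow> p) F \<longleftrightarrow> (\<forall>r. \<forall>\<^sub>F n in F. net2_balls_iso r p (X n))"
  by (rule local_topology_tendsto_iff)
    (auto simp: open_doubly_rooted_network_def intro: net2_balls_iso_refl net2_balls_iso_trans)

lemma rooted_tree_tendsto_iff:
  "(X \<longlongrightarrow> p) F \<longleftrightarrow> (\<forall>r. \<forall>\<^sub>F n in F. tree1_balls_iso r p (X n))"
  by (rule local_topology_tendsto_iff)
    (auto simp: open_rooted_tree_def intro: tree1_balls_iso_refl tree1_balls_iso_trans)


section \<open>Unimodularity\<close>

lemma mass_cong:
  assumes "network_iso \<sigma> G H" "is_network G" "is_network H" "x \<in> verts G"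
  shows "(\<integral>\<^sup>+u. g (net2 G x u) \<partial>count_space (verts G)) =
         (\<integral>\<^sup>+v. g (net2 H (\<sigma> x) v) \<partial>count_space (verts H))" (is ?out)
    and "(\<integral>\<^sup>+u. g (net2 G u x) \<partial>count_space (verts G)) =
         (\<integral>\<^sup>+v. g (net2 H v (\<sigma> x)) \<partial>count_space (verts H))" (is ?in)
proof -
  have b: "bij_betw \<sigma> (verts G) (verts H)" using assms(1) by (simp add: network_iso_def graph_iso_def)
  have e: "net2 G u v = net2 H (\<sigma> u) (\<sigma> v)" if "u \<in> verts G" "v \<in> verts G" for u v
    using assms that by (intro net2_eqI) (auto simp: net2_rel_iff)
  show ?out
    unfolding nn_integral_bij_count_space[OF b, symmetric]
    using assms(4) by (auto intro!: nn_integral_cong simp: e)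
  show ?in
    unfolding nn_integral_bij_count_space[OF b, symmetric]
    using assms(4) by (auto intro!: nn_integral_cong simp: e)
qed

text \<open>\<open>\<Sum>\<^sub>u g [G, x, u]\<close> and \<open>\<Sum>\<^sub>u g [G, u, x]\<close> as functions of \<open>[G, x]\<close>.\<close>

lift_definition mass_out :: "(doubly_rooted_network \<Rightarrow> ennreal) \<Rightarrow> rooted_network \<Rightarrow> ennreal" is
  "\<lambda>g (G, x). \<integral>\<^sup>+u. g (net2 G x u) \<partial>count_space (verts G)"
  by (auto simp: net1_rel_iff mass_cong(1))

lift_definition mass_in :: "(doubly_rooted_network \<Rightarrow> ennreal) \<Rightarrow> rooted_network \<Rightarrow> ennreal" is
  "\<lambda>g (G, x). \<integral>\<^sup>+u. g (net2 G u x) \<partial>count_space (verts G)"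
  by (auto simp: net1_rel_iff mass_cong(2))

definition unimodular :: "rooted_network measure \<Rightarrow> bool" where
  "unimodular P \<longleftrightarrow> prob_space P \<and> sets P = sets borel \<and>
     (\<forall>g :: doubly_rooted_network \<Rightarrow> real. g \<in> borel_measurable borel \<longrightarrow> (\<forall>z. 0 \<le> g z) \<longrightarrow>
        (\<integral>\<^sup>+p. mass_out (\<lambda>z. ennreal (g z)) p \<partial>P) = (\<integral>\<^sup>+p. mass_in (\<lambda>z. ennreal (g z)) p \<partial>P))"


section \<open>Vertex-shifts\<close>

type_synonym vertex_map = "network \<Rightarrow> nat \<Rightarrow> nat"

definition vertex_shift :: "vertex_map \<Rightarrow> bool" where
  "vertex_shift f \<longleftrightarrow>
     (\<forall>G. is_network G \<longrightarrow> (\<forall>v\<in>verts G. f G v \<in> verts G)) \<and>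
     (\<forall>G H \<sigma>. is_network G \<longrightarrow> is_network H \<longrightarrow> network_iso \<sigma> G H \<longrightarrow>
        (\<forall>v\<in>verts G. f H (\<sigma> v) = \<sigma> (f G v))) \<and>
     (indicator {net2 G u v | G u v. is_network G \<and> u \<in> verts G \<and> v \<in> verts G \<and> f G u = v}
        :: doubly_rooted_network \<Rightarrow> real) \<in> borel_measurable borel"

text \<open>\<open>\<theta>\<^sub>f\<close>, defined through a representative; the choice is immaterial for a vertex-shift.\<close>

definition shift_map :: "vertex_map \<Rightarrow> rooted_network \<Rightarrow> rooted_network" where
  "shift_map f p = (case rep_rooted_network p of (G, x) \<Rightarrow> net1 G (f G x))"

lemma shift_map_net1:
  assumes f: "vertex_shift f" and G: "is_network G" "x \<in> verts G"
  shows "shift_map f (net1 G x) = net1 G (f G x)"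
proof -
  obtain H y where r: "rep_rooted_network (net1 G x) = (H, y)" by fastforce
  have rel: "net1_rel (H, y) (G, x)" using rep_net1[OF G] r by simp
  then obtain \<sigma> where s: "is_network H" "y \<in> verts H" "network_iso \<sigma> H G" "\<sigma> y = x"
    by (auto simp: net1_rel_iff)
  have "f G (\<sigma> y) = \<sigma> (f H y)"
    using f s(1-3) G(1) by (simp add: vertex_shift_def)
  moreover have V: "f H y \<in> verts H" "f G x \<in> verts G"
    using f s(1,2) G by (simp_all add: vertex_shift_def)
  ultimately have "net1_rel (H, f H y) (G, f G x)"
    unfolding net1_rel_iff using s G by metis
  then show ?thesis using s(1) G(1) V by (simp add: shift_map_def r net1_eq_iff)
qed

definition shift_graph :: "vertex_map \<Rightarrow> network \<Rightarrow> graph" where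
  "shift_graph f G = \<lparr>verts = verts G, arcs = {(u, f G u) | u. u \<in> verts G \<and> f G u \<noteq> u}\<rparr>"

definition component :: "'a graph_scheme \<Rightarrow> nat \<Rightarrow> 'a graph_scheme" where
  "component G x = induced G {v. (x, v) \<in> (adj G)\<^sup>*}"

definition shift_components_family_trees :: "vertex_map \<Rightarrow> bool" where
  "shift_components_family_trees f \<longleftrightarrow>
     (\<forall>G. is_network G \<longrightarrow> (\<forall>x\<in>verts G. is_family_tree (component (shift_graph f G) x)))"

text \<open>\<open>\<Psi>\<^sub>f\<close>, again defined through a representative.\<close>

definition forward_map :: "vertex_map \<Rightarrow> rooted_network \<Rightarrow> rooted_tree" where
  "forward_map f p =
     (case rep_rooted_network p of (G, x) \<Rightarrow> tree1 (component (shift_graph f G) x) x)"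

lemma forward_map_net1:
  assumes f: "vertex_shift f" "shift_components_family_trees f" and G: "is_network G" "x \<in> verts G"
  shows "forward_map f (net1 G x) = tree1 (component (shift_graph f G) x) x"
proof -
  obtain H y where r: "rep_rooted_network (net1 G x) = (H, y)" by fastforce
  have rel: "net1_rel (H, y) (G, x)" using rep_net1[OF G] r by simp
  then obtain \<sigma> where s: "is_network H" "y \<in> verts H" "network_iso \<sigma> H G" "\<sigma> y = x"
    by (auto simp: net1_rel_iff)
  have fV: "f K v \<in> verts K" if "is_network K" "v \<in> verts K" for K v
    using f(1) that by (auto simp: vertex_shift_def)
  have eq: "f G (\<sigma> v) = \<sigma> (f H v)" if "v \<in> verts H" for v
    using f(1) s(1,3) G(1) that by (simp add: vertex_shift_def)
  have b: "bij_betw \<sigma> (verts H) (verts G)" using s(3) by (simp add: network_iso_def graph_iso_def)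
  then have inj: "\<sigma> u = \<sigma> v \<longleftrightarrow> u = v" if "u \<in> verts H" "v \<in> verts H" for u v
    using that by (auto simp: bij_betw_def inj_on_def)
  let ?A = "shift_graph f H" and ?B = "shift_graph f G"
  have arcs: "(u, v) \<in> arcs (shift_graph f K) \<longleftrightarrow> u \<in> verts K \<and> v = f K u \<and> v \<noteq> u" for u v K
    by (auto simp: shift_graph_def)
  have V: "verts (shift_graph f K) = verts K" for K by (simp add: shift_graph_def)
  have "(u, v) \<in> arcs ?A \<longleftrightarrow> (\<sigma> u, \<sigma> v) \<in> arcs ?B" if uv: "u \<in> verts H" "v \<in> verts H" for u v
  proof -
    have "\<sigma> u \<in> verts G" using b uv by (auto simp: bij_betw_def)
    moreover have "\<sigma> v = f G (\<sigma> u) \<longleftrightarrow> v = f H u" using eq inj fV[OF s(1)] uv by simp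
    ultimately show ?thesis using uv inj by (simp add: arcs)
  qed
  then have iso: "graph_iso \<sigma> ?A ?B" using b by (simp add: graph_iso_def V)
  have wf: "wf_graph (shift_graph f K)" if "is_network K" for K
    using fV that by (auto simp: wf_graph_def V arcs irrefl_def)
  have reach: "{v. (z, v) \<in> (adj K)\<^sup>*} = (\<Union>r. ball_verts r K {z})" for z and K :: graph
    by (auto simp: ball_verts_def rtrancl_power)
  have "\<sigma> ` {v. (y, v) \<in> (adj ?A)\<^sup>*} = {v. (x, v) \<in> (adj ?B)\<^sup>*}"
    unfolding reach image_UN
    using graph_iso_ball_verts[OF iso wf[OF s(1)] wf[OF G(1)], of "{y}"] s(2,4) by (simp add: V)
  moreover have "{v. (y, v) \<in> (adj ?A)\<^sup>*} \<subseteq> verts ?A"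
    unfolding reach using ball_verts_subset[OF wf[OF s(1)], of "{y}"] s(2) by (auto simp: V)
  ultimately have "graph_iso \<sigma> (component ?A y) (component ?B x)"
    using graph_iso_induced[OF iso, of "{v. (y, v) \<in> (adj ?A)\<^sup>*}"] by (simp add: component_def)
  then have "tree1_rel (component ?A y, y) (component ?B x, x)"
    using f(2) s G by (auto simp: tree1_rel_iff shift_components_family_trees_def component_def V)
  then show ?thesis by (simp add: forward_map_def r tree1_eqI)
qed


section \<open>The parent vertex-shift\<close>

definition parent :: "graph \<Rightarrow> nat \<Rightarrow> nat" where
  "parent T v = (if \<exists>w. (v, w) \<in> arcs T then THE w. (v, w) \<in> arcs T else v)"

lemma parent_eq: "single_valued (arcs T) \<Longrightarrow> (v, w) \<in> arcs T \<Longrightarrow> parent T v = w"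
  by (auto simp: parent_def single_valued_def)

lemma parent_iso:
  assumes "graph_iso \<sigma> S T" "is_family_tree S" "is_family_tree T" "v \<in> verts S"
  shows "parent T (\<sigma> v) = \<sigma> (parent S v)" "parent S v \<in> verts S"
proof -
  have sv: "single_valued (arcs S)" "single_valued (arcs T)" and wf: "wf_graph S" "wf_graph T"
    using assms by (auto simp: is_family_tree_def directed_tree_def)
  have b: "bij_betw \<sigma> (verts S) (verts T)" using assms(1) by (simp add: graph_iso_def)
  have "parent T (\<sigma> v) = \<sigma> (parent S v) \<and> parent S v \<in> verts S"
  proof (cases "\<exists>w. (v, w) \<in> arcs S")
    case True
    then obtain w where w: "(v, w) \<in> arcs S" by auto
    then have wV: "w \<in> verts S" using wf by (auto simp: wf_graph_def)
    then have "(\<sigma> v, \<sigma> w) \<in> arcs T" using w assms by (auto simp: graph_iso_def)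
    then show ?thesis using w wV sv by (simp add: parent_eq)
  next
    case False
    have "(\<sigma> v, w) \<notin> arcs T" for w
    proof
      assume a: "(\<sigma> v, w) \<in> arcs T"
      then have "w \<in> verts T" using wf by (auto simp: wf_graph_def)
      then obtain u where "u \<in> verts S" "w = \<sigma> u" using b by (auto simp: bij_betw_def)
      then show False using a False assms by (auto simp: graph_iso_def)
    qed
    then show ?thesis using False assms by (simp add: parent_def)
  qed
  then show "parent T (\<sigma> v) = \<sigma> (parent S v)" "parent S v \<in> verts S" by auto
qed

lift_definition parent_shift :: "rooted_tree \<Rightarrow> rooted_tree" is "\<lambda>(T, x). (T, parent T x)"
  by (clarsimp simp: tree1_rel_iff) (metis parent_iso)


section \<open>Weak convergence and limit probabilities of shifts\<close>

definition weakly_converges :: "(nat \<Rightarrow> 'a :: topological_space measure) \<Rightarrow> 'a measure \<Rightarrow> bool" where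
  "weakly_converges M M' \<longleftrightarrow>
     (\<forall>h :: 'a \<Rightarrow> real. continuous_on UNIV h \<longrightarrow> bounded (range h) \<longrightarrow>
        (\<lambda>n. integral\<^sup>L (M n) h) \<longlonglongrightarrow> integral\<^sup>L M' h)"

text \<open>\<open>R\<close> is the weak limit of the push-forwards of \<open>M\<close> under the iterates of \<open>\<theta>\<close>: the
  \<open>f\<close>-probability of \<open>M\<close> for \<open>\<theta> = \<theta>\<^sub>f\<close> and the \<open>F\<close>-probability for \<open>\<theta> = \<theta>\<^sub>F\<close>.\<close>

definition shift_probability ::
    "('a :: topological_space \<Rightarrow> 'a) \<Rightarrow> 'a measure \<Rightarrow> 'a measure \<Rightarrow> bool" where
  "shift_probability \<theta> M R \<longleftrightarrow> prob_space R \<and> sets R = sets borel \<and>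
     weakly_converges (\<lambda>n. distr M borel (\<theta> ^^ n)) R"

end

theory Submission
  imports Defs
begin

text \<open>
  Since \<open>f\<close> acts on the \<open>f\<close>-graph as the parent shift, \<open>\<Psi>\<^sub>f \<circ> \<theta>\<^sub>f = \<theta>\<^sub>F \<circ> \<Psi>\<^sub>f\<close>. By unimodularity
  \<open>\<theta>\<^sub>f\<close> pulls null sets back to null sets, so \<open>\<Phi>\<^sub>f \<circ> \<Psi>\<^sub>f = Id\<close> also holds almost surely after any
  number of shifts. Hence \<open>\<theta>\<^sub>f\<^sup>n = \<Phi>\<^sub>f \<circ> \<theta>\<^sub>F\<^sup>n \<circ> \<Psi>\<^sub>f\<close> almost surely, that is,
  \<open>P\<^sub>n\<close> is the push-forward of \<open>Q\<^sub>n\<close> under \<open>\<Phi>\<^sub>f\<close>, and the claim is the continuous mapping theorem.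
\<close>

section \<open>Measure theory: push-forwards and almost surely continuous test functions\<close>

text \<open>For a non-measurable map from a finite measure space, \<^const>\<open>distr\<close> takes the null measure as
  junk value: otherwise a set \<open>A\<close> with a non-measurable preimage and its complement would both be
  null. Measurability of \<open>\<Psi>\<^sub>f\<close> and of the iterates of \<open>\<theta>\<^sub>F\<close> is thus implicit in
  the weak convergence of the \<open>Q\<^sub>n\<close> to a probability measure.\<close>

lemma distr_nonzero_imp_measurable:
  assumes M: "finite_measure M" and f: "f \<in> space M \<rightarrow> space N"
    and nz: "emeasure (distr M N f) (space N) \<noteq> 0"
  shows "f \<in> M \<rightarrow>\<^sub>M N"
proof (rule measurableI)
  let ?\<mu> = "\<lambda>A. emeasure M (f -` A \<inter> space M)"
  have distr: "emeasure (distr M N f) A =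
      (if A \<in> sets N \<and> measure_space (space N) (sets N) ?\<mu> then ?\<mu> A else 0)" for A
    unfolding distr_def
    by (subst emeasure_measure_of_conv) (simp add: sets.sigma_sets_eq)
  \<comment> \<open>The \<open>measure_space\<close> condition does not depend on \<open>A\<close>,
    so a nonzero total mass excludes the junk branch for every measurable set at once.\<close>
  then have eq: "emeasure (distr M N f) A = ?\<mu> A" if "A \<in> sets N" for A
    using that nz by (metis)
  show "f x \<in> space N" if "x \<in> space M" for x using f that by auto
  show "f -` A \<inter> space M \<in> sets M" if A: "A \<in> sets N" for A
  proof (rule ccontr)
    assume n: "f -` A \<inter> space M \<notin> sets M"
    have "f -` (space N - A) \<inter> space M \<notin> sets M"
    proof
      assume "f -` (space N - A) \<inter> space M \<in> sets M"
      moreover have "f -` A \<inter> space M = space M - (f -` (space N - A) \<inter> space M)"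
        using f by auto
      ultimately show False using n by (metis sets.compl_sets)
    qed
    then have "emeasure (distr M N f) A + emeasure (distr M N f) (space N - A) = 0"
      using n A by (simp add: eq emeasure_notin_sets)
    moreover have "emeasure (distr M N f) A + emeasure (distr M N f) (space N - A)
        = emeasure (distr M N f) (space N)"
      using A sets.sets_into_space[OF A] by (subst plus_emeasure) (auto simp: Un_absorb1)
    ultimately show False using nz by simp
  qed
qed

text \<open>The relation \<open>R r\<close> is an equivalence relation with open classes, so the infimum of \<open>\<phi>\<close> over
  the \<open>R r\<close>-class of a point is locally constant in that point; it approximates \<open>\<phi>\<close> from below.\<close>

lemma weakly_converges_integral_lower:
  fixes \<phi> :: "'a :: topological_space \<Rightarrow> real" and M :: "nat \<Rightarrow> 'a measure"
  assumes op: "\<And>U :: 'a set. open U \<longleftrightarrow> (\<forall>x\<in>U. \<exists>r::nat. \<forall>y. R r x y \<longrightarrow> y \<in> U)"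
    and refl: "\<And>r x. R r x x" and sym: "\<And>r x y. R r x y \<Longrightarrow> R r y x"
    and trans: "\<And>r x y z. R r x y \<Longrightarrow> R r y z \<Longrightarrow> R r x z"
    and mono: "\<And>r s x y. R s x y \<Longrightarrow> r \<le> s \<Longrightarrow> R r x y"
    and conv: "weakly_converges M L"
    and M: "\<forall>\<^sub>F n in sequentially. finite_measure (M n) \<and> sets (M n) = sets borel"
    and L: "finite_measure L" "sets L = sets borel"
    and \<phi>: "\<phi> \<in> borel_measurable borel" "\<And>x. \<bar>\<phi> x\<bar> \<le> K"
    and cont: "AE x in L. (\<phi> \<longlongrightarrow> \<phi> x) (nhds x)"
    and e: "e > 0"
  shows "\<forall>\<^sub>F n in sequentially. integral\<^sup>L L \<phi> - e < integral\<^sup>L (M n) \<phi>"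
proof -
  define \<psi> where "\<psi> r x = (INF y\<in>{y. R r x y}. \<phi> y)" for r x
  have bdd: "bdd_below (\<phi> ` S)" for S
    using \<phi>(2) by (intro bdd_belowI2[of _ "- K"]) (metis abs_le_D2 minus_le_iff)
  have \<psi>_le: "\<psi> r x \<le> \<phi> y" if "R r x y" for r x y
    unfolding \<psi>_def using that by (intro cINF_lower bdd) auto
  have \<psi>_ge: "c \<le> \<psi> r x" if "\<And>y. R r x y \<Longrightarrow> c \<le> \<phi> y" for r x c
    unfolding \<psi>_def using that refl by (intro cINF_greatest) auto
  have \<psi>_const: "\<psi> r y = \<psi> r x" if "R r x y" for r x y
  proof -
    have "R r x = R r y" using that sym trans by blast
    then show ?thesis by (simp add: \<psi>_def)
  qed
  have \<psi>_abs: "\<bar>\<psi> r x\<bar> \<le> K" for r x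
    using \<psi>_le[OF refl, of r x] \<psi>_ge[of r x "- K"] \<phi>(2) by (metis abs_le_iff minus_le_iff order_trans)
  have \<psi>_cont: "continuous_on UNIV (\<psi> r)" for r
  proof -
    \<comment> \<open>The preimage of an arbitrary \<open>B\<close> is a union of
      \<open>R r\<close>-classes, hence open.\<close>
    have "open (\<psi> r -` B)" for B
      unfolding op using \<psi>_const by (auto intro!: exI[of _ r])
    then show ?thesis by (simp add: continuous_on_open_vimage)
  qed
  have \<psi>_meas: "\<psi> r \<in> borel_measurable borel" for r
    using \<psi>_cont by (rule borel_measurable_continuous_onI)
  have int: "integrable N g" if "finite_measure N" "sets N = sets borel" "g \<in> borel_measurable borel"
    "\<And>x. \<bar>g x\<bar> \<le> K" for N and g :: "'a \<Rightarrow> real"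
    using that by (intro finite_measure.integrable_const_bound[of N g K])
      (auto simp: measurable_cong_sets[OF that(2) HOL.refl])
  have lim: "(\<lambda>r. \<psi> r x) \<longlonglongrightarrow> \<phi> x" if "(\<phi> \<longlongrightarrow> \<phi> x) (nhds x)" for x
  proof (rule LIMSEQ_I)
    fix d :: real assume "d > 0"
    then have "\<forall>\<^sub>F y in nhds x. dist (\<phi> y) (\<phi> x) < d/2"
      using tendstoD[OF that, of "d/2"] by simp
    then obtain U where "open U" "x \<in> U" "\<And>y. y \<in> U \<Longrightarrow> dist (\<phi> y) (\<phi> x) < d/2"
      by (auto simp: eventually_nhds)
    then obtain r where r: "\<And>y. R r x y \<Longrightarrow> dist (\<phi> y) (\<phi> x) < d/2" unfolding op by meson
    \<comment> \<open>Passing to the infimum makes the bound non-strict; starting from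
      \<open>d/2\<close> keeps the final one strict. Above, \<open>\<psi> s x \<le> \<phi> x\<close>
      suffices.\<close>
    have "norm (\<psi> s x - \<phi> x) < d" if "s \<ge> r" for s
    proof -
      have "\<phi> x - d/2 \<le> \<phi> y" if "R s x y" for y
        using r[OF mono[OF that \<open>s \<ge> r\<close>]] unfolding dist_real_def by linarith
      then have "\<phi> x - d/2 \<le> \<psi> s x" by (rule \<psi>_ge)
      then show ?thesis using \<psi>_le[OF refl, of s x] \<open>d > 0\<close> by (simp add: abs_if)
    qed
    then show "\<exists>no. \<forall>n\<ge>no. norm (\<psi> n x - \<phi> x) < d" by blast
  qed
  have "(\<lambda>r. integral\<^sup>L L (\<psi> r)) \<longlonglongrightarrow> integral\<^sup>L L \<phi>"
  proof (rule integral_dominated_convergence[where w = "\<lambda>_. K"])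
    show "\<phi> \<in> borel_measurable L" "\<psi> r \<in> borel_measurable L" for r
      using \<phi>(1) \<psi>_meas L(2) by (auto simp: measurable_cong_sets[OF L(2) HOL.refl])
    show "integrable L (\<lambda>_. K)" using L(1) by (simp add: finite_measure.integrable_const)
    show "AE x in L. (\<lambda>r. \<psi> r x) \<longlonglongrightarrow> \<phi> x" using cont by (rule AE_mp) (auto intro!: AE_I2 lim)
    show "AE x in L. norm (\<psi> r x) \<le> K" for r using \<psi>_abs by simp
  qed
  then have "\<forall>\<^sub>F r in sequentially. integral\<^sup>L L \<phi> - e < integral\<^sup>L L (\<psi> r)"
    using e by (intro order_tendstoD(1)) auto
  \<comment> \<open>Fixing one such \<open>r\<close> leaves a bounded continuous function, to which
    weak convergence applies; \<open>\<psi> r \<le> \<phi>\<close> then carries the bound over to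
    \<open>\<phi>\<close>.\<close>
  then obtain r where r: "integral\<^sup>L L \<phi> - e < integral\<^sup>L L (\<psi> r)"
    by (auto simp: eventually_sequentially)
  have "(\<lambda>n. integral\<^sup>L (M n) (\<psi> r)) \<longlonglongrightarrow> integral\<^sup>L L (\<psi> r)"
    using conv \<psi>_cont[of r] \<psi>_abs[of r] unfolding weakly_converges_def bounded_iff
    by (metis rangeE real_norm_def)
  then have "\<forall>\<^sub>F n in sequentially. integral\<^sup>L L \<phi> - e < integral\<^sup>L (M n) (\<psi> r)"
    using r by (rule order_tendstoD(1))
  with M show ?thesis
  proof eventually_elim
    case (elim n)
    have "integral\<^sup>L (M n) (\<psi> r) \<le> integral\<^sup>L (M n) \<phi>"
      using elim(1) \<psi>_meas \<psi>_abs \<phi> \<psi>_le refl by (intro integral_mono int) auto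
    then show ?case using elim(2) by simp
  qed
qed

text \<open>The hypotheses are invariant under \<open>\<phi> \<mapsto> - \<phi>\<close>, so the
  one-sided estimate for both functions bounds the integrals from both sides.\<close>

lemma weakly_converges_AE_continuous:
  fixes \<phi> :: "'a :: topological_space \<Rightarrow> real" and M :: "nat \<Rightarrow> 'a measure"
  assumes op: "\<And>U :: 'a set. open U \<longleftrightarrow> (\<forall>x\<in>U. \<exists>r::nat. \<forall>y. R r x y \<longrightarrow> y \<in> U)"
    and R: "\<And>r x. R r x x" "\<And>r x y. R r x y \<Longrightarrow> R r y x"
      "\<And>r x y z. R r x y \<Longrightarrow> R r y z \<Longrightarrow> R r x z"
      "\<And>r s x y. R s x y \<Longrightarrow> r \<le> s \<Longrightarrow> R r x y"
    and conv: "weakly_converges M L"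
    and M: "\<forall>\<^sub>F n in sequentially. finite_measure (M n) \<and> sets (M n) = sets borel"
    and L: "finite_measure L" "sets L = sets borel"
    and \<phi>: "\<phi> \<in> borel_measurable borel" "\<And>x. \<bar>\<phi> x\<bar> \<le> K"
    and cont: "AE x in L. (\<phi> \<longlongrightarrow> \<phi> x) (nhds x)"
  shows "(\<lambda>n. integral\<^sup>L (M n) \<phi>) \<longlonglongrightarrow> integral\<^sup>L L \<phi>"
proof (rule tendstoI)
  fix e :: real assume e: "e > 0"
  note lower = weakly_converges_integral_lower[of R, OF op R conv M L _ _ _ e]
  have "\<forall>\<^sub>F n in sequentially. integral\<^sup>L L \<phi> - e < integral\<^sup>L (M n) \<phi>"
    by (rule lower) (use \<phi> cont in auto)
  moreover have "\<forall>\<^sub>F n in sequentially.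
      integral\<^sup>L L (\<lambda>x. - \<phi> x) - e < integral\<^sup>L (M n) (\<lambda>x. - \<phi> x)"
  proof (rule lower)
    show "AE x in L. ((\<lambda>x. - \<phi> x) \<longlongrightarrow> - \<phi> x) (nhds x)"
      using cont by (rule AE_mp) (intro AE_I2 impI tendsto_minus)
  qed (use \<phi> in auto)
  ultimately show "\<forall>\<^sub>F n in sequentially. dist (integral\<^sup>L (M n) \<phi>) (integral\<^sup>L L \<phi>) < e"
    by eventually_elim (auto simp: dist_real_def abs_if)
qed

section \<open>Isomorphisms of balls and change of roots\<close>

lemma tree1_balls_iso_sym: "tree1_balls_iso r p q \<Longrightarrow> tree1_balls_iso r q p"
proof (transfer, clarsimp simp: tree1_rel_iff tree_balls_iso_def)
  fix r S x T \<sigma>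
  assume x: "x \<in> verts S" and \<sigma>: "graph_iso \<sigma> (root_ball r S {x}) (root_ball r T {\<sigma> x})"
  have "x \<in> verts (root_ball r S {x})"
    using x roots_subset_ball[of "{x}" r S] by (simp add: root_ball_def)
  then have "the_inv_into (verts (root_ball r S {x})) \<sigma> (\<sigma> x) = x"
    using \<sigma> by (intro the_inv_into_f_f) (auto simp: graph_iso_def bij_betw_def)
  then show "\<exists>\<tau>. graph_iso \<tau> (root_ball r T {\<sigma> x}) (root_ball r S {x}) \<and> \<tau> (\<sigma> x) = x"
    using graph_iso_inv[OF \<sigma>] by blast
qed

text \<open>A walk of length at most \<open>r\<close> from \<open>S\<close> visits only vertices of
  the ball, so it never leaves \<open>B\<close>.\<close>

lemma ball_verts_induced:
  assumes "ball_verts r G S \<subseteq> B"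
  shows "ball_verts r (induced G B) S = ball_verts r G S"
proof -
  have "(x, v) \<in> adj (induced G B) ^^ k \<longleftrightarrow> (x, v) \<in> adj G ^^ k" if "x \<in> S" "k \<le> r" for x v k
    using that(2)
  proof (induction k arbitrary: v)
    case (Suc k)
    have "w \<in> B" if "(x, w) \<in> adj G ^^ l" "l \<le> r" for w l
      using assms that \<open>x \<in> S\<close> unfolding ball_verts_def by blast
    then have "w \<in> B \<and> v \<in> B" if "(x, w) \<in> adj G ^^ k" "(w, v) \<in> adj G" for w
      using that Suc.prems relpow_Suc_I[OF that] by (meson Suc_leD)
    then show ?case using Suc by (auto simp: relcomp.simps)
  qed simp
  then show ?thesis unfolding ball_verts_def by blast
qed

lemma root_ball_induced:
  assumes "ball_verts r G S \<subseteq> B"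
  shows "root_ball r (induced G B) S = root_ball r G S"
  unfolding root_ball_def ball_verts_induced[OF assms]
  using assms by (auto simp: induced_def Int_absorb1 Int_absorb2 Int_assoc
      intro!: arg_cong2[where f = "\<lambda>A B. G\<lparr>verts := A, arcs := B\<rparr>"])

lemma ball_verts_triangle:
  assumes "S \<subseteq> ball_verts d G R"
  shows "ball_verts r G S \<subseteq> ball_verts (d + r) G R"
proof
  fix v assume "v \<in> ball_verts r G S"
  then obtain u k where u: "u \<in> S" "k \<le> r" "(u, v) \<in> adj G ^^ k" by (auto simp: ball_verts_def)
  then obtain x l where x: "x \<in> R" "l \<le> d" "(x, u) \<in> adj G ^^ l" using assms by (auto simp: ball_verts_def)
  have "(x, v) \<in> adj G ^^ (l + k)" using x u by (auto simp: relpow_add)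
  then show "v \<in> ball_verts (d + r) G R"
    unfolding ball_verts_def using x u by (auto intro!: bexI[of _ x] exI[of _ "l + k"])
qed

text \<open>By the triangle inequality the \<open>r\<close>-ball around \<open>S\<close> lies inside
  the \<open>(d + r)\<close>-ball around \<open>R\<close>, where \<open>\<sigma>\<close> is defined,
  and balls computed inside the larger ball agree with those of the whole graph. This allows roots
  to be added or dropped in the local topology.\<close>

lemma network_iso_reroot:
  assumes \<sigma>: "network_iso \<sigma> (root_ball (d + r) G R) (root_ball (d + r) H (\<sigma> ` R))"
    and wf: "wf_graph G" "wf_graph H" and R: "R \<subseteq> verts G" and S: "S \<subseteq> ball_verts d G R"
  shows "\<sigma> ` S \<subseteq> ball_verts d H (\<sigma> ` R)"
    and "network_iso \<sigma> (root_ball r G S) (root_ball r H (\<sigma> ` S))"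
proof -
  let ?G = "root_ball (d + r) G R" and ?H = "root_ball (d + r) H (\<sigma> ` R)"
  have wf': "wf_graph ?G" "wf_graph ?H" using wf by auto
  have iso: "graph_iso \<sigma> ?G ?H" using \<sigma> by (simp add: network_iso_def)
  have ball: "ball_verts d (root_ball (d + r) K X) X = ball_verts d K X" for K :: network and X
    unfolding root_ball_def by (intro ball_verts_induced ball_verts_mono) simp
  have RG: "R \<subseteq> verts ?G" using R roots_subset_ball[of R "d + r" G] by (auto simp: root_ball_def)
  have "ball_verts d H (\<sigma> ` R) = \<sigma> ` ball_verts d G R"
    using graph_iso_ball_verts[OF iso wf' RG, of d] by (simp add: ball)
  then show *: "\<sigma> ` S \<subseteq> ball_verts d H (\<sigma> ` R)" using S by auto
  have "S \<subseteq> verts ?G"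
    using S ball_verts_subset[OF wf(1) R, of d] ball_verts_mono[of d "d + r" G R]
    by (auto simp: root_ball_def)
  from network_iso_root_ball[OF \<sigma> wf' this, of r]
  show "network_iso \<sigma> (root_ball r G S) (root_ball r H (\<sigma> ` S))"
    unfolding root_ball_def[of "d + r"]
    using root_ball_induced[OF ball_verts_triangle[OF S]] root_ball_induced[OF ball_verts_triangle[OF *]]
    by simp
qed


section \<open>Representatives of isomorphism classes and the second root\<close>

lemma rooted_network_cases:
  obtains G x where "is_network G" "x \<in> verts G" "p = net1 G x"
proof -
  obtain G x where Gx: "rep_rooted_network p = (G, x)" by fastforce
  have "net1_rel (G, x) (G, x)"
    using Quotient3_rep_reflp[OF Quotient3_rooted_network, of p] by (simp add: Gx)
  moreover have "p = net1 G x"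
    using Quotient3_abs_rep[OF Quotient3_rooted_network, of p] by (simp add: Gx net1_def)
  ultimately show thesis using that by (auto simp: net1_rel_iff)
qed

lemma doubly_rooted_network_cases:
  obtains G x u where "is_network G" "x \<in> verts G" "u \<in> verts G" "z = net2 G x u"
proof -
  obtain G x u where Gx: "rep_doubly_rooted_network z = (G, x, u)" by (metis surj_pair)
  have "net2_rel (G, x, u) (G, x, u)"
    using Quotient3_rep_reflp[OF Quotient3_doubly_rooted_network, of z] by (simp add: Gx)
  moreover have "z = net2 G x u"
    using Quotient3_abs_rep[OF Quotient3_doubly_rooted_network, of z] by (simp add: Gx net2_def)
  ultimately show thesis using that by (auto simp: net2_rel_iff)
qed

lemma net2_rel_refl:
  "is_network G \<Longrightarrow> x \<in> verts G \<Longrightarrow> u \<in> verts G \<Longrightarrow> net2_rel (G, x, u) (G, x, u)"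
  by (auto simp: net2_rel_iff intro!: exI[of _ id] network_iso_id)

lemma net2_eqD:
  assumes "is_network G" "x \<in> verts G" "u \<in> verts G" "is_network H" "y \<in> verts H" "v \<in> verts H"
    and "net2 G x u = net2 H y v"
  shows "net2_rel (G, x, u) (H, y, v)"
  using assms Quotient3_rel[OF Quotient3_doubly_rooted_network, of "(G, x, u)" "(H, y, v)"]
  by (auto simp: net2_def net2_rel_refl)

lemma net1_balls_iso_net1:
  assumes "is_network G" "x \<in> verts G" "is_network H" "y \<in> verts H"
  shows "net1_balls_iso r (net1 G x) (net1 H y) \<longleftrightarrow>
    (\<exists>\<sigma>. network_iso \<sigma> (root_ball r G {x}) (root_ball r H {y}) \<and> \<sigma> x = y)"
  unfolding net1_def using assms
  by (subst net1_balls_iso.abs_eq) (auto simp: net1_rel_refl net_balls_iso_def)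

lemma net2_balls_iso_net2:
  assumes "is_network G" "x \<in> verts G" "u \<in> verts G" "is_network H" "y \<in> verts H" "v \<in> verts H"
  shows "net2_balls_iso r (net2 G x u) (net2 H y v) \<longleftrightarrow>
    (\<exists>\<sigma>. network_iso \<sigma> (root_ball r G {x, u}) (root_ball r H {y, v}) \<and> \<sigma> x = y \<and> \<sigma> u = v)"
  unfolding net2_def using assms
  by (subst net2_balls_iso.abs_eq) (auto simp: net2_rel_refl net_balls_iso_def)

text \<open>Turns a Borel condition on the class seen from the target of a mass transport into a
  Borel condition on doubly rooted networks.\<close>

lift_definition second_root :: "doubly_rooted_network \<Rightarrow> rooted_network" is "\<lambda>(G, x, u). (G, u)"
  by (auto simp: net1_rel_iff net2_rel_iff)

lemma second_root_net2:
  assumes "is_network G" "x \<in> verts G" "u \<in> verts G"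
  shows "second_root (net2 G x u) = net1 G u"
  unfolding net1_def net2_def using assms
  by (subst second_root.abs_eq) (auto simp: net2_rel_refl)

lemma continuous_second_root: "continuous_on UNIV second_root"
proof -
  have "net1_balls_iso r (second_root z) (second_root w)" if zw: "net2_balls_iso r z w" for r z w
  proof -
    obtain G x u where G: "is_network G" "x \<in> verts G" "u \<in> verts G" "z = net2 G x u"
      by (rule doubly_rooted_network_cases)
    obtain H y v where H: "is_network H" "y \<in> verts H" "v \<in> verts H" "w = net2 H y v"
      by (rule doubly_rooted_network_cases)
    obtain \<sigma> where \<sigma>: "network_iso \<sigma> (root_ball r G {x, u}) (root_ball r H {y, v})" "\<sigma> x = y" "\<sigma> u = v"
      using zw G H by (auto simp: net2_balls_iso_net2)
    \<comment> \<open>Distance 0 is enough: forgetting a root costs no radius.\<close>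
    have "{u} \<subseteq> ball_verts 0 G {x, u}" using roots_subset_ball[of "{x, u}" 0 G] by blast
    with network_iso_reroot(2)[of \<sigma> 0 r G "{x, u}" H "{u}"]
    have "network_iso \<sigma> (root_ball r G {u}) (root_ball r H {v})"
      using \<sigma> G(1-3) H(1) by (simp add: is_network_wf)
    then show ?thesis
      unfolding G(4) H(4) second_root_net2[OF G(1-3)] second_root_net2[OF H(1-3)]
        net1_balls_iso_net1[OF G(1,3) H(1,3)]
      using \<sigma>(3) by blast
  qed
  then have "open (second_root -` U)" if "open U" for U
    using that unfolding open_rooted_network_def open_doubly_rooted_network_def vimage_def
    by blast
  then show ?thesis by (simp add: continuous_on_open_vimage)
qed

section \<open>Measurability of the outgoing mass\<close>

lemma finite_ball_verts:
  assumes "is_network G" "x \<in> verts G"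
  shows "finite (ball_verts d G {x})"
proof (induction d)
  case 0
  then show ?case by (simp add: ball_verts_def)
next
  case (Suc d)
  have wf: "wf_graph G" using assms by (simp add: is_network_wf)
  have "ball_verts (Suc d) G {x} \<subseteq> ball_verts d G {x} \<union> (\<Union>w\<in>ball_verts d G {x}. adj G `` {w})"
  proof
    fix v assume "v \<in> ball_verts (Suc d) G {x}"
    then obtain k where k: "k \<le> Suc d" "(x, v) \<in> adj G ^^ k" by (auto simp: ball_verts_def)
    show "v \<in> ball_verts d G {x} \<union> (\<Union>w\<in>ball_verts d G {x}. adj G `` {w})"
    proof (cases "k \<le> d")
      case True
      then show ?thesis using k by (auto simp: ball_verts_def)
    next
      case False
      then have "k = Suc d" using k by simp
      then obtain w where "(x, w) \<in> adj G ^^ d" "(w, v) \<in> adj G" using k by auto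
      then show ?thesis by (auto simp: ball_verts_def)
    qed
  qed
  moreover have "finite (adj G `` {w})" if "w \<in> ball_verts d G {x}" for w
    using ball_verts_subset[OF wf, of "{x}" d] that assms
    by (auto simp: is_network_def locally_finite_def)
  ultimately show ?case using Suc by (meson finite_UN_I finite_UnI finite_subset)
qed

lemma Union_ball_verts:
  assumes "is_network G" "x \<in> verts G"
  shows "(\<Union>d. ball_verts d G {x}) = verts G"
proof
  show "(\<Union>d. ball_verts d G {x}) \<subseteq> verts G"
    using assms ball_verts_subset[of G "{x}"] by (auto simp: is_network_wf)
  show "verts G \<subseteq> (\<Union>d. ball_verts d G {x})"
  proof
    fix v assume "v \<in> verts G"
    then have "(x, v) \<in> (adj G)\<^sup>*" using assms by (auto simp: is_network_def connected_graph_def)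
    then show "v \<in> (\<Union>d. ball_verts d G {x})" by (auto simp: rtrancl_power ball_verts_def)
  qed
qed

lemma mass_ball_cong:
  assumes "network_iso \<sigma> G H" "is_network G" "is_network H" "x \<in> verts G"
  shows "(\<integral>\<^sup>+u. g (net2 G x u) \<partial>count_space (ball_verts d G {x})) =
         (\<integral>\<^sup>+v. g (net2 H (\<sigma> x) v) \<partial>count_space (ball_verts d H {\<sigma> x}))"
proof -
  have iso: "graph_iso \<sigma> G H" and b: "bij_betw \<sigma> (verts G) (verts H)"
    using assms(1) by (simp_all add: network_iso_def graph_iso_def)
  have V: "ball_verts d G {x} \<subseteq> verts G"
    using assms by (intro ball_verts_subset) (auto simp: is_network_wf)
  have "ball_verts d H {\<sigma> x} = \<sigma> ` ball_verts d G {x}"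
    using graph_iso_ball_verts[OF iso, of "{x}" d] assms by (simp add: is_network_wf)
  then have b': "bij_betw \<sigma> (ball_verts d G {x}) (ball_verts d H {\<sigma> x})"
    using b V by (metis bij_betw_subset)
  have "net2 G x u = net2 H (\<sigma> x) (\<sigma> u)" if "u \<in> ball_verts d G {x}" for u
    using assms that V by (intro net2_eqI) (auto simp: net2_rel_iff)
  then show ?thesis
    unfolding nn_integral_bij_count_space[OF b', symmetric] by (auto intro!: nn_integral_cong)
qed

text \<open>Truncation of \<open>mass_out\<close> to targets within distance \<open>d\<close> of the
  root. For an indicator it is a finite count, which makes subtraction legitimate and lets a finite
  radius control it.\<close>

lift_definition mass_ball ::
    "nat \<Rightarrow> (doubly_rooted_network \<Rightarrow> ennreal) \<Rightarrow> rooted_network \<Rightarrow> ennreal" is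
  "\<lambda>d g (G, x). \<integral>\<^sup>+u. g (net2 G x u) \<partial>count_space (ball_verts d G {x})"
  by (auto simp: net1_rel_iff mass_ball_cong)

lemma mass_net1:
  assumes "is_network G" "x \<in> verts G"
  shows "mass_ball d g (net1 G x) = (\<integral>\<^sup>+u. g (net2 G x u) \<partial>count_space (ball_verts d G {x}))"
    and "mass_out g (net1 G x) = (\<integral>\<^sup>+u. g (net2 G x u) \<partial>count_space (verts G))"
    and "mass_in g (net1 G x) = (\<integral>\<^sup>+u. g (net2 G u x) \<partial>count_space (verts G))"
  unfolding net1_def using net1_rel_refl[OF assms]
  by (simp_all add: mass_ball.abs_eq mass_out.abs_eq mass_in.abs_eq)

lemma mass_ball_indicator_net1:
  assumes "is_network G" "x \<in> verts G"
  shows "mass_ball d (indicator B) (net1 G x) =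
    of_nat (card {u \<in> ball_verts d G {x}. net2 G x u \<in> B})" (is "_ = of_nat (card ?C)")
proof -
  have "(\<integral>\<^sup>+u. indicator B (net2 G x u) \<partial>count_space (ball_verts d G {x})) =
      (\<integral>\<^sup>+u. indicator ?C u \<partial>count_space (ball_verts d G {x}))"
    by (intro nn_integral_cong) (auto simp: indicator_def)
  also have "\<dots> = emeasure (count_space (ball_verts d G {x})) ?C"
    by (intro nn_integral_indicator) auto
  also have "\<dots> = of_nat (card ?C)"
    using finite_ball_verts[OF assms, of d] by (intro emeasure_count_space_finite) auto
  finally show ?thesis using assms by (simp add: mass_net1)
qed

text \<open>Monotone convergence: the balls increase with \<open>d\<close> and exhaust the network
  because it is connected.\<close>

lemma mass_out_eq_SUP: "mass_out g p = (SUP d. mass_ball d g p)"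
proof -
  obtain G x where G: "is_network G" "x \<in> verts G" "p = net1 G x" by (rule rooted_network_cases)
  let ?B = "\<lambda>d. ball_verts d G {x}" and ?g = "\<lambda>u. g (net2 G x u)"
  have "incseq (\<lambda>d u. ?g u * indicator (?B d) u)"
    using ball_verts_mono[of _ _ G "{x}"]
    by (force simp: incseq_def le_fun_def indicator_def)
  then have "(SUP d. \<integral>\<^sup>+u. ?g u * indicator (?B d) u \<partial>count_space UNIV) =
      (\<integral>\<^sup>+u. (SUP d. ?g u * indicator (?B d) u) \<partial>count_space UNIV)"
    by (intro nn_integral_monotone_convergence_SUP[symmetric]) auto
  also have "\<dots> = (\<integral>\<^sup>+u. ?g u * indicator (verts G) u \<partial>count_space UNIV)"
  proof (rule nn_integral_cong)
    fix u
    show "(SUP d. ?g u * indicator (?B d) u) = ?g u * indicator (verts G) u"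
    proof (cases "u \<in> verts G")
      case True
      then obtain d where d: "u \<in> ?B d" using Union_ball_verts[OF G(1,2)] by auto
      show ?thesis
      proof (rule antisym)
        show "(SUP d. ?g u * indicator (?B d) u) \<le> ?g u * indicator (verts G) u"
          using True by (intro SUP_least) (auto simp: indicator_def)
        show "?g u * indicator (verts G) u \<le> (SUP d. ?g u * indicator (?B d) u)"
          using d True by (intro SUP_upper2[of d]) (auto simp: indicator_def)
      qed
    next
      case False
      then have "u \<notin> ?B d" for d using Union_ball_verts[OF G(1,2)] by auto
      then show ?thesis using False by simp
    qed
  qed
  finally show ?thesis
    using G by (simp add: mass_net1 nn_integral_count_space_indicator)
qed

text \<open>An isomorphism of the balls of radius \<open>d + r\<close> maps vertices \<open>u\<close> within distance \<open>d\<close> of the root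
  to such vertices, and preserves the balls of radius \<open>r\<close> around the root and \<open>u\<close>.\<close>

lemma open_mass_ball_greater:
  assumes U: "open U"
  shows "open {p. a < mass_ball d (indicator U) p}"
  unfolding open_rooted_network_def
proof
  fix p assume p: "p \<in> {p. a < mass_ball d (indicator U) p}"
  obtain G x where G: "is_network G" "x \<in> verts G" "p = net1 G x" by (rule rooted_network_cases)
  let ?C = "{u \<in> ball_verts d G {x}. net2 G x u \<in> U}"
  have CV: "?C \<subseteq> verts G" using G ball_verts_subset[of G "{x}" d] by (auto simp: is_network_wf)
  have fin: "finite ?C" using finite_ball_verts[OF G(1,2), of d] by auto
  have "\<forall>u\<in>?C. \<exists>r. \<forall>w. net2_balls_iso r (net2 G x u) w \<longrightarrow> w \<in> U"
    using U unfolding open_doubly_rooted_network_def by auto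
  then obtain r where r: "\<And>u w. u \<in> ?C \<Longrightarrow> net2_balls_iso (r u) (net2 G x u) w \<Longrightarrow> w \<in> U"
    by metis
  \<comment> \<open>A common radius for the finitely many vertices in \<open>?C\<close>; inserting 0
    keeps \<open>Max\<close> meaningful when \<open>?C\<close> is empty.\<close>
  define s where "s = Max (insert 0 (r ` ?C))"
  have s: "w \<in> U" if "u \<in> ?C" "net2_balls_iso s (net2 G x u) w" for u w
  proof -
    have "r u \<le> s" using fin that(1) unfolding s_def by (intro Max_ge) auto
    then show ?thesis using r that net2_balls_iso_mono by blast
  qed
  show "\<exists>r. \<forall>q. net1_balls_iso r p q \<longrightarrow> q \<in> {p. a < mass_ball d (indicator U) p}"
  proof (intro exI[of _ "d + s"] allI impI)
    fix q assume q: "net1_balls_iso (d + s) p q"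
    obtain H y where H: "is_network H" "y \<in> verts H" "q = net1 H y" by (rule rooted_network_cases)
    obtain \<sigma> where \<sigma>: "network_iso \<sigma> (root_ball (d + s) G {x}) (root_ball (d + s) H {y})" "\<sigma> x = y"
      using q G H by (auto simp: net1_balls_iso_net1)
    have wf: "wf_graph G" "wf_graph H" using G H by (simp_all add: is_network_wf)
    have xb: "x \<in> ball_verts d G {x}" using roots_subset_ball[of "{x}" d G] by simp
    have ball: "\<sigma> u \<in> ball_verts d H {y}"
      and iso: "network_iso \<sigma> (root_ball s G {x, u}) (root_ball s H {y, \<sigma> u})"
      if "u \<in> ball_verts d G {x}" for u
      using network_iso_reroot[of \<sigma> d s G "{x}" H "{x, u}"] \<sigma> wf G(2) that xb by auto
    have "\<sigma> ` ?C \<subseteq> {v \<in> ball_verts d H {y}. net2 H y v \<in> U}"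
    proof safe
      fix u assume u: "u \<in> ball_verts d G {x}" "net2 G x u \<in> U"
      then show "\<sigma> u \<in> ball_verts d H {y}" using ball by blast
      then have "\<sigma> u \<in> verts H" using ball_verts_subset[OF wf(2), of "{y}" d] H by auto
      then have "net2_balls_iso s (net2 G x u) (net2 H y (\<sigma> u))"
        using u CV G H \<sigma>(2) iso[OF u(1)] by (subst net2_balls_iso_net2) auto
      then show "net2 H y (\<sigma> u) \<in> U" using s u by blast
    qed
    then have "card (\<sigma> ` ?C) \<le> card {v \<in> ball_verts d H {y}. net2 H y v \<in> U}"
      using finite_ball_verts[OF H(1,2), of d] by (intro card_mono) auto
    \<comment> \<open>Injectivity ensures that no target is lost in the count for
      \<open>q\<close>.\<close>
    moreover have "inj_on \<sigma> ?C"
    proof (rule inj_on_subset)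
      show "inj_on \<sigma> (verts (root_ball (d + s) G {x}))"
        using \<sigma>(1) by (simp add: network_iso_def graph_iso_def bij_betw_def)
      show "?C \<subseteq> verts (root_ball (d + s) G {x})"
        using CV ball_verts_mono[of d "d + s" G "{x}"] by (auto simp: root_ball_def)
    qed
    then have "card (\<sigma> ` ?C) = card ?C" by (rule card_image)
    ultimately have "mass_ball d (indicator U) p \<le> mass_ball d (indicator U) q"
      using G H by (simp add: mass_ball_indicator_net1)
    then show "q \<in> {p. a < mass_ball d (indicator U) p}" using p by auto
  qed
qed

text \<open>Dynkin's argument from the open sets, an intersection-stable generator. Open sets have
  open superlevel sets, complements become differences of finite counts, and disjoint unions become
  series.\<close>

lemma mass_ball_indicator_measurable:
  assumes "B \<in> sets borel"
  shows "mass_ball d (indicator B) \<in> borel_measurable borel"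
proof -
  have "Int_stable {S :: doubly_rooted_network set. open S}" by (auto simp: Int_stable_def)
  moreover have "{S :: doubly_rooted_network set. open S} \<subseteq> Pow UNIV" by simp
  moreover have "B \<in> sigma_sets UNIV {S. open S}" using assms by (simp add: borel_def)
  ultimately show ?thesis
  proof (induction rule: sigma_sets_induct_disjoint)
    case (basic A)
    then show ?case by (intro borel_measurableI_greater) (simp add: borel_open open_mass_ball_greater)
  next
    case empty
    have "mass_ball d (indicator {}) p = 0" for p
      by (rule rooted_network_cases[of p]) (simp add: mass_ball_indicator_net1)
    then show ?case by (subst measurable_cong) auto
  next
    case (compl A)
    \<comment> \<open>\<open>UNIV\<close> is itself open; its mass is the number of vertices in the
      ball.\<close>
    have "mass_ball d (indicator UNIV) \<in> borel_measurable borel"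
      by (rule borel_measurableI_greater)
        (use borel_open[OF open_mass_ball_greater[OF open_UNIV]] in simp)
    moreover have "mass_ball d (indicator (UNIV - A)) p =
        mass_ball d (indicator UNIV) p - mass_ball d (indicator A) p" for p
    proof -
      obtain G x where G: "is_network G" "x \<in> verts G" "p = net1 G x" by (rule rooted_network_cases)
      let ?B = "ball_verts d G {x}"
      have fin: "finite ?B" using finite_ball_verts[OF G(1,2)] .
      have "{u \<in> ?B. net2 G x u \<notin> A} = ?B - {u \<in> ?B. net2 G x u \<in> A}" by auto
      then have "card {u \<in> ?B. net2 G x u \<notin> A} = card ?B - card {u \<in> ?B. net2 G x u \<in> A}"
        using fin by (simp add: card_Diff_subset)
      then show ?thesis
        using G fin by (simp add: mass_ball_indicator_net1 ennreal_of_nat_eq_real_of_nat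
            of_nat_diff card_mono ennreal_minus del: indicator_UNIV)
    qed
    ultimately show ?case using compl
      by (subst measurable_cong[where g = "\<lambda>p. mass_ball d (indicator UNIV) p - mass_ball d (indicator A) p"]) auto
  next
    case (union A)
    have "mass_ball d (indicator (\<Union>i. A i)) p = (\<Sum>i. mass_ball d (indicator (A i)) p)" for p
    proof -
      obtain G x where G: "is_network G" "x \<in> verts G" "p = net1 G x" by (rule rooted_network_cases)
      show ?thesis
        using G union(1) by (simp add: mass_net1 nn_integral_suminf[symmetric] suminf_indicator)
    qed
    then show ?case using union
      by (subst measurable_cong[where g = "\<lambda>p. \<Sum>i. mass_ball d (indicator (A i)) p"]) auto
  qed
qed

lemma mass_out_indicator_measurable:
  assumes "B \<in> sets borel"
  shows "mass_out (indicator B) \<in> borel_measurable borel"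
  using mass_ball_indicator_measurable[OF assms]
  by (subst measurable_cong[OF mass_out_eq_SUP]) auto

section \<open>Measurability of the vertex-shift and preservation of null sets\<close>

definition shift_pairs :: "vertex_map \<Rightarrow> doubly_rooted_network set" where
  "shift_pairs f = {net2 G u v | G u v. is_network G \<and> u \<in> verts G \<and> v \<in> verts G \<and> f G u = v}"

text \<open>Membership only provides some representative with \<open>f H y\<close> as second root;
  equivariance of \<open>f\<close> carries this along the isomorphism to the given one.\<close>

lemma net2_in_shift_pairs_iff:
  assumes f: "vertex_shift f" and G: "is_network G" "x \<in> verts G" "u \<in> verts G"
  shows "net2 G x u \<in> shift_pairs f \<longleftrightarrow> f G x = u"
proof
  assume "net2 G x u \<in> shift_pairs f"
  then obtain H y where H: "is_network H" "y \<in> verts H" "f H y \<in> verts H" "net2 G x u = net2 H y (f H y)"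
    unfolding shift_pairs_def by blast
  have "net2_rel (H, y, f H y) (G, x, u)" using G H by (intro net2_eqD) auto
  then obtain \<sigma> where "network_iso \<sigma> H G" "\<sigma> y = x" "\<sigma> (f H y) = u"
    by (auto simp: net2_rel_iff)
  then show "f G x = u" using f G H by (auto simp: vertex_shift_def)
next
  assume "f G x = u"
  then show "net2 G x u \<in> shift_pairs f" using G by (auto simp: shift_pairs_def)
qed

lemma shift_pairs_measurable: "vertex_shift f \<Longrightarrow> shift_pairs f \<in> sets borel"
  by (simp add: vertex_shift_def shift_pairs_def borel_measurable_indicator_iff)

lemma shift_pairs_second_root_measurable:
  assumes "vertex_shift f" "A \<in> sets borel"
  shows "shift_pairs f \<inter> second_root -` A \<in> sets borel"
  using shift_pairs_measurable[OF assms(1)]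
    measurable_sets[OF borel_measurable_continuous_onI[OF continuous_second_root] assms(2)]
  by simp

text \<open>The root sends mass to the single vertex \<open>f G x\<close>, so the sum has at most
  one nonzero term.\<close>

lemma mass_out_shift_pairs:
  assumes f: "vertex_shift f"
  shows "mass_out (indicator (shift_pairs f \<inter> second_root -` A)) p = indicator A (shift_map f p)"
proof -
  obtain G x where G: "is_network G" "x \<in> verts G" "p = net1 G x" by (rule rooted_network_cases)
  have fV: "f G x \<in> verts G" using f G by (simp add: vertex_shift_def)
  have "(\<integral>\<^sup>+u. indicator (shift_pairs f \<inter> second_root -` A) (net2 G x u) \<partial>count_space (verts G)) =
      (\<integral>\<^sup>+u. indicator A (net1 G (f G x)) * indicator {f G x} u \<partial>count_space (verts G))"
    using f G by (intro nn_integral_cong)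
      (auto simp: net2_in_shift_pairs_iff second_root_net2 indicator_def)
  also have "\<dots> = indicator A (net1 G (f G x)) * emeasure (count_space (verts G)) {f G x}"
    using fV by (intro nn_integral_cmult_indicator) auto
  also have "\<dots> = indicator A (shift_map f p)"
    using f G fV by (simp add: shift_map_net1)
  finally show ?thesis using G by (simp add: mass_net1)
qed

text \<open>The preimage of \<open>A\<close> is the level set at 1 of a measurable outgoing
  mass.\<close>

lemma shift_map_measurable:
  assumes f: "vertex_shift f"
  shows "shift_map f \<in> borel \<rightarrow>\<^sub>M borel"
proof (rule measurableI)
  fix A :: "rooted_network set" assume A: "A \<in> sets borel"
  let ?m = "mass_out (indicator (shift_pairs f \<inter> second_root -` A))"
  have "?m \<in> borel_measurable borel"
    using shift_pairs_second_root_measurable[OF f A] by (rule mass_out_indicator_measurable)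
  then have "?m -` {1} \<inter> space borel \<in> sets borel" by (rule measurable_sets) simp
  moreover have "?m -` {1} = shift_map f -` A"
    by (auto simp: mass_out_shift_pairs[OF f] indicator_def split: if_splits)
  ultimately show "shift_map f -` A \<inter> space borel \<in> sets borel" by simp
qed simp

text \<open>The mass transport principle applied to \<open>g [G, x, u] = 1\<close> if \<open>f\<^sub>G x = u\<close> and \<open>[G, u]\<close> lies in a
  null set.\<close>

lemma AE_shift_map:
  assumes P: "unimodular P" and f: "vertex_shift f" and Q: "AE p in P. Q p"
  shows "AE p in P. Q (shift_map f p)"
proof -
  have sP: "sets P = sets borel" using P by (simp add: unimodular_def)
  have spP: "space P = UNIV" using sets_eq_imp_space_eq[OF sP] by simp
  obtain N where N: "{p. \<not> Q p} \<subseteq> N" "N \<in> sets borel" "emeasure P N = 0"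
    using Q by (rule AE_E) (auto simp: sP spP)
  let ?B = "shift_pairs f \<inter> second_root -` N"
  have B: "?B \<in> sets borel" using f N(2) by (rule shift_pairs_second_root_measurable)
  then have "(indicator ?B :: _ \<Rightarrow> real) \<in> borel_measurable borel" by simp
  moreover have "\<forall>z. (0::real) \<le> indicator ?B z" by simp
  ultimately have "(\<integral>\<^sup>+p. mass_out (\<lambda>z. ennreal (indicator ?B z)) p \<partial>P) =
      (\<integral>\<^sup>+p. mass_in (\<lambda>z. ennreal (indicator ?B z)) p \<partial>P)"
    using P unfolding unimodular_def by blast
  then have eq: "(\<integral>\<^sup>+p. mass_out (indicator ?B) p \<partial>P) = (\<integral>\<^sup>+p. mass_in (indicator ?B) p \<partial>P)"
    by (simp add: ennreal_indicator)
  \<comment> \<open>For incoming mass the second root is the root of \<open>p\<close> itself, so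
    each term requires \<open>p \<in> N\<close>.\<close>
  have "mass_in (indicator ?B) p = 0" if "p \<notin> N" for p
  proof -
    obtain G x where G: "is_network G" "x \<in> verts G" "p = net1 G x" by (rule rooted_network_cases)
    have "(\<integral>\<^sup>+u. indicator ?B (net2 G u x) \<partial>count_space (verts G)) = (\<integral>\<^sup>+u. 0 \<partial>count_space (verts G))"
      using G that by (intro nn_integral_cong) (auto simp: second_root_net2 indicator_def)
    then show ?thesis using G by (simp add: mass_net1)
  qed
  moreover have "AE p in P. p \<notin> N" using N sP by (intro AE_not_in) auto
  ultimately have "AE p in P. mass_in (indicator ?B) p = 0" by (auto elim: AE_mp)
  then have "(\<integral>\<^sup>+p. mass_in (indicator ?B) p \<partial>P) = (\<integral>\<^sup>+p. 0 \<partial>P)" by (rule nn_integral_cong_AE)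
  then have "(\<integral>\<^sup>+p. mass_out (indicator ?B) p \<partial>P) = 0" using eq by simp
  moreover have "mass_out (indicator ?B) \<in> borel_measurable P"
    using mass_out_indicator_measurable[OF B] by (simp add: measurable_cong_sets[OF sP refl])
  ultimately have "AE p in P. mass_out (indicator ?B) p = 0" by (simp add: nn_integral_0_iff_AE)
  then show ?thesis
  proof (rule AE_mp, intro AE_I2 impI)
    fix p assume "mass_out (indicator ?B) p = 0"
    then have "shift_map f p \<notin> N" by (auto simp: mass_out_shift_pairs[OF f] indicator_def split: if_splits)
    then show "Q (shift_map f p)" using N(1) by auto
  qed
qed

section \<open>Intertwining of the two shifts and the limit theorem\<close>

text \<open>A vertex and its image under \<open>f\<close> lie in the same component of the
  \<open>f\<close>-graph, so only the root moves, and it moves along its outgoing arc.\<close>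

lemma forward_map_shift_map:
  assumes f: "vertex_shift f" "shift_components_family_trees f"
  shows "forward_map f (shift_map f p) = parent_shift (forward_map f p)"
proof -
  obtain G x where G: "is_network G" "x \<in> verts G" "p = net1 G x" by (rule rooted_network_cases)
  let ?S = "shift_graph f G"
  let ?C = "component ?S x"
  have fV: "f G x \<in> verts G" using f G by (simp add: vertex_shift_def)
  have tree: "is_family_tree ?C" using f G by (auto simp: shift_components_family_trees_def)
  have xC: "x \<in> verts ?C" using G by (simp add: component_def shift_graph_def)
  have arcs: "(x, f G x) \<in> adj ?S" if "f G x \<noteq> x"
    using that G by (auto simp: adj_def shift_graph_def)
  have "(x, f G x) \<in> (adj ?S)\<^sup>*" using arcs by (cases "f G x = x") auto
  moreover have "(f G x, x) \<in> (adj ?S)\<^sup>*" using arcs by (cases "f G x = x") (auto simp: adj_def)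
  ultimately have "{v. (f G x, v) \<in> (adj ?S)\<^sup>*} = {v. (x, v) \<in> (adj ?S)\<^sup>*}"
    by (auto intro: rtrancl_trans)
  then have comp: "component ?S (f G x) = ?C" by (simp add: component_def)
  have "parent ?C x = f G x"
  proof (cases "f G x = x")
    \<comment> \<open>The self-loop is discarded, so \<open>x\<close> has no outgoing arc and
      \<open>parent\<close> returns its default \<open>x\<close>.\<close>
    case True
    then have "(x, w) \<notin> arcs ?C" for w by (auto simp: component_def shift_graph_def)
    then show ?thesis using True by (simp add: parent_def)
  next
    case False
    then have "(x, f G x) \<in> arcs ?C"
      using G arcs by (auto simp: component_def shift_graph_def)
    then show ?thesis using tree by (intro parent_eq) (simp_all add: is_family_tree_def)
  qed
  moreover have "parent_shift (tree1 ?C x) = tree1 ?C (parent ?C x)"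
    unfolding tree1_def using tree xC
    by (subst parent_shift.abs_eq) (auto simp: tree1_rel_iff intro!: exI[of _ id] graph_iso_id)
  ultimately show ?thesis
    using f G fV by (simp add: shift_map_net1 forward_map_net1 comp)
qed

theorem lemma61:
  fixes P :: "rooted_network measure"
    and f :: vertex_map
    and \<Phi> :: "rooted_tree \<Rightarrow> rooted_network"
    and QF :: "rooted_tree measure"
  assumes "unimodular P"
    and "vertex_shift f"
    and "shift_components_family_trees f"
    and "\<Phi> \<in> borel \<rightarrow>\<^sub>M borel"
    and "prob_space QF" and "sets QF = sets borel"
    and "AE p in P. \<Phi> (forward_map f p) = p"
    and "shift_probability parent_shift (distr P borel (forward_map f)) QF"
    and "AE T in QF. (\<Phi> \<longlongrightarrow> \<Phi> T) (at T)"
  shows "shift_probability (shift_map f) P (distr QF borel \<Phi>)"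
proof -
  interpret P: prob_space P using assms(1) by (simp add: unimodular_def)
  interpret QF: prob_space QF by fact
  have sP: "sets P = sets borel" using assms(1) by (simp add: unimodular_def)
  let ?\<Psi> = "forward_map f" and ?\<theta> = "shift_map f"
  define Q where "Q = distr P borel ?\<Psi>"
  define Qn where "Qn n = distr Q borel (parent_shift ^^ n)" for n
  have conv: "weakly_converges Qn QF"
    using assms(8) by (simp add: shift_probability_def Q_def Qn_def[abs_def])
  \<comment> \<open>The constant test function 1 shows that the total masses tend to 1, so for large
    \<open>n\<close> the push-forwards are not the junk null measure.\<close>
  have "(\<lambda>n. integral\<^sup>L (Qn n) (\<lambda>_. 1 :: real)) \<longlonglongrightarrow> integral\<^sup>L QF (\<lambda>_. 1)"
    using conv[unfolded weakly_converges_def, rule_format, of "\<lambda>_. 1"] by simp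
  then have "(\<lambda>n. measure (Qn n) UNIV) \<longlonglongrightarrow> 1"
    using QF.prob_space sets_eq_imp_space_eq[OF assms(6)] by (simp add: Qn_def)
  then have "\<forall>\<^sub>F n in sequentially. 0 < measure (Qn n) UNIV" by (rule order_tendstoD(1)) simp
  then have ev: "\<forall>\<^sub>F n in sequentially. emeasure (Qn n) UNIV \<noteq> 0"
    by eventually_elim (auto simp: measure_def)
  have \<Psi>: "?\<Psi> \<in> P \<rightarrow>\<^sub>M borel"
  proof (rule distr_nonzero_imp_measurable)
    obtain n where n: "emeasure (Qn n) UNIV \<noteq> 0" using ev by (auto simp: eventually_sequentially)
    show "emeasure (distr P borel ?\<Psi>) (space borel) \<noteq> 0"
    proof
      assume "emeasure (distr P borel ?\<Psi>) (space borel) = 0"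
      \<comment> \<open>A vanishing \<open>Q\<close> has vanishing push-forwards, whether or not the
        map is measurable.\<close>
      then have "emeasure Q A = 0" for A
        using emeasure_mono[of A UNIV Q] by (cases "A \<in> sets Q") (auto simp: Q_def emeasure_notin_sets)
      then have "emeasure (Qn n) UNIV = 0"
        unfolding Qn_def distr_def by (simp add: emeasure_measure_of_conv)
      then show False using n by simp
    qed
  qed (auto intro: P.finite_measure_axioms)
  interpret Q: prob_space Q unfolding Q_def by (rule P.prob_space_distr[OF \<Psi>])
  have sQ: "sets Q = sets borel" by (simp add: Q_def)
  have F: "\<forall>\<^sub>F n in sequentially. parent_shift ^^ n \<in> Q \<rightarrow>\<^sub>M borel"
    using ev
    by eventually_elim (rule distr_nonzero_imp_measurable, auto simp: Qn_def intro: Q.finite_measure_axioms)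
  then have Qn: "\<forall>\<^sub>F n in sequentially. finite_measure (Qn n) \<and> sets (Qn n) = sets borel"
    by eventually_elim (auto simp: Qn_def intro: Q.finite_measure_distr)
  have inv: "AE p in P. \<Phi> (?\<Psi> ((?\<theta> ^^ n) p)) = (?\<theta> ^^ n) p" for n
  proof (induction n)
    case (Suc n)
    \<comment> \<open>The induction hypothesis is evaluated at the shifted network, where
      unimodularity keeps it almost sure.\<close>
    then show ?case using AE_shift_map[OF assms(1,2) Suc] by (simp add: funpow_swap1)
  qed (use assms(7) in simp)
  have comm: "?\<Psi> ((?\<theta> ^^ n) p) = (parent_shift ^^ n) (?\<Psi> p)" for n p
    by (induction n) (simp_all add: forward_map_shift_map[OF assms(2,3)])
  have \<theta>: "?\<theta> ^^ n \<in> P \<rightarrow>\<^sub>M borel" for n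
  proof -
    have "?\<theta> ^^ n \<in> borel \<rightarrow>\<^sub>M borel"
      using shift_map_measurable[OF assms(2)] by (induction n) (auto intro: measurable_comp)
    then show ?thesis by (simp add: measurable_cong_sets[OF sP refl])
  qed
  have \<Phi>: "\<Phi> \<in> QF \<rightarrow>\<^sub>M borel" using assms(4) by (simp add: measurable_cong_sets[OF assms(6) refl])
  have "(\<lambda>n. integral\<^sup>L (distr P borel (?\<theta> ^^ n)) h) \<longlonglongrightarrow> integral\<^sup>L (distr QF borel \<Phi>) h"
    if h: "continuous_on UNIV h" "bounded (range h)" for h :: "rooted_network \<Rightarrow> real"
  proof -
    have hm: "h \<in> borel_measurable borel" using h(1) by (rule borel_measurable_continuous_onI)
    have \<phi>m: "(\<lambda>T. h (\<Phi> T)) \<in> borel_measurable borel" using assms(4) hm by simp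
    obtain K where K: "\<And>x. \<bar>h x\<bar> \<le> K" using h(2) by (auto simp: bounded_iff)
    have "(\<lambda>n. integral\<^sup>L (Qn n) (\<lambda>T. h (\<Phi> T))) \<longlonglongrightarrow> integral\<^sup>L QF (\<lambda>T. h (\<Phi> T))"
    proof (rule weakly_converges_AE_continuous[OF open_rooted_tree_def tree1_balls_iso_refl
          tree1_balls_iso_sym tree1_balls_iso_trans tree1_balls_iso_mono conv Qn
          QF.finite_measure_axioms assms(6) \<phi>m K])
      show "AE T in QF. ((\<lambda>T. h (\<Phi> T)) \<longlongrightarrow> h (\<Phi> T)) (nhds T)"
      proof (rule AE_mp[OF assms(9)], intro AE_I2 impI)
        fix T assume "(\<Phi> \<longlongrightarrow> \<Phi> T) (at T)"
        \<comment> \<open>The limit equals the value at \<open>T\<close>, so the punctured filter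
          may be replaced by the full one.\<close>
        then have "(\<Phi> \<longlongrightarrow> \<Phi> T) (nhds T)" by (rule tendsto_at_iff_tendsto_nhds[THEN iffD1])
        moreover have "(h \<longlongrightarrow> h (\<Phi> T)) (nhds (\<Phi> T))"
          using h(1) by (simp add: continuous_on_def flip: tendsto_at_iff_tendsto_nhds)
        ultimately show "((\<lambda>T. h (\<Phi> T)) \<longlongrightarrow> h (\<Phi> T)) (nhds T)"
          by (rule filterlim_compose[rotated])
      qed
    qed
    moreover have "integral\<^sup>L QF (\<lambda>T. h (\<Phi> T)) = integral\<^sup>L (distr QF borel \<Phi>) h"
      using \<Phi> hm by (simp add: integral_distr)
    \<comment> \<open>The change of variables uses measurability of
      \<open>parent_shift ^^ n\<close>, known here for large \<open>n\<close>; this is enough for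
      the limit.\<close>
    moreover have "\<forall>\<^sub>F n in sequentially.
        integral\<^sup>L (Qn n) (\<lambda>T. h (\<Phi> T)) = integral\<^sup>L (distr P borel (?\<theta> ^^ n)) h"
      using F
    proof eventually_elim
      case (elim n)
      have "integral\<^sup>L (Qn n) (\<lambda>T. h (\<Phi> T)) = (\<integral>T. h (\<Phi> ((parent_shift ^^ n) T)) \<partial>Q)"
        unfolding Qn_def by (rule integral_distr[OF elim \<phi>m])
      also have "\<dots> = (\<integral>p. h (\<Phi> ((parent_shift ^^ n) (?\<Psi> p))) \<partial>P)"
        unfolding Q_def using elim \<phi>m sQ
        by (intro integral_distr[OF \<Psi>] measurable_compose[OF _ \<phi>m]) (simp add: Q_def)
      also have "\<dots> = (\<integral>p. h ((?\<theta> ^^ n) p) \<partial>P)"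
      proof (rule integral_cong_AE)
        show "AE p in P. h (\<Phi> ((parent_shift ^^ n) (?\<Psi> p))) = h ((?\<theta> ^^ n) p)"
          using inv[of n] by (rule AE_mp) (simp add: comm)
        have "?\<Psi> \<in> P \<rightarrow>\<^sub>M Q" using \<Psi> by (simp add: measurable_cong_sets[OF refl sQ])
        from measurable_compose[OF measurable_compose[OF this elim] \<phi>m]
        show "(\<lambda>p. h (\<Phi> ((parent_shift ^^ n) (?\<Psi> p)))) \<in> borel_measurable P" .
      qed (rule measurable_compose[OF \<theta> hm])
      also have "\<dots> = integral\<^sup>L (distr P borel (?\<theta> ^^ n)) h"
        by (rule integral_distr[OF \<theta> hm, symmetric])
      finally show ?case .
    qed
    ultimately show ?thesis using Lim_transform_eventually by fastforce
  qed
  then show ?thesis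
    using QF.prob_space_distr[OF \<Phi>] by (simp add: shift_probability_def weakly_converges_def)
qed

end
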